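(* Let $F$ be a non-abelian free group, let $\Delta$ be a decomposition of $F$, let $\phi\colon F\to\mathbb{R}$ be a $\Delta$-decomposable quasimorphism and let $\omega$ be a symmetric, $\Delta$-continuous $2$-cocycle on $F$. Define $\zeta\in C^3(F,\mathbb{R})$ by $$\zeta(g,h,i)=\sum_{j=1}^{k}\phi(g_j)\,\omega(g_{j+1}\cdots g_k h,\,i)\quad\text{for }\Delta(g)=(g_1,\ldots,g_k),$$ define $\eta\in C^2(F,\mathbb{R})$ by $\eta(g,h)=\zeta(g,1,h)$, and define $\gamma\in C^2(F,\mathbb{R})$ by $$\gamma(g,h)=\tfrac12\big(\zeta(d,d^{-1},d)+\zeta(d^{-1},1,d)\big),$$ where $d$ is the common $2$-path of $(g,h)$. Then the map $\beta\in C^3(F,\mathbb{R})$ defined by $$\beta(g,h,i)=\phi(g)\,\omega(h,i)+\delta^2\gamma(g,h,i)+\delta^2\eta(g,h,i)$$ is bounded, i.e. $\beta\in C^3_b(F,\mathbb{R})$.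
   Context: $F$ is a non-abelian free group on a fixed free generating set. Cochains. $C^k(F,\mathbb{R})$ is the set of all functions $F^k\to\mathbb{R}$ and $C^k_b(F,\mathbb{R})$ the subset of bounded functions. $\delta^1\alpha(g,h)=\alpha(g)-\alpha(gh)+\alpha(h)$ and $\delta^2\alpha(g,h,i)=\alpha(h,i)-\alpha(gh,i)+\alpha(g,hi)-\alpha(g,h)$. A quasimorphism is a map $\alpha\colon F\to\mathbb{R}$ with $\delta^1\alpha$ bounded; it is symmetric if $\alpha(g^{-1})=-\alpha(g)$ for all $g$. Sequences. A set $\mathcal{P}\subset F$ is symmetric if $p\in\mathcal{P}$ implies $p^{-1}\in\mathcal{P}$. $\mathcal{P}^*$ is the set of finite (possibly empty) sequences in $\mathcal{P}$. For $(\underline{a})=(a_1,\ldots,a_k)$, $(\underline{a}^{-1})=(a_k^{-1},\ldots,a_1^{-1})$. The dot denotes concatenation. The common sequence of two sequences is their longest common initial segment (possibly empty). A product $a_1\cdots a_k$ in $F$ is said to be reduced (no cancellation) if concatenating the reduced words of $a_1,\ldots,a_k$ gives a reduced word. Decompositions. Let $\mathcal{P}\subset F$ be a symmetric set (the pieces) not containing the identity. A decomposition of $F$ into the pieces $\mathcal{P}$ is a map $\Delta\colon F\to\mathcal{P}^*$ such that: (1) for every $g$ with $\Delta(g)=(g_1,\ldots,g_k)$, $g=g_1\cdots g_k$ as a reduced word, and $\Delta(g^{-1})=(g_k^{-1},\ldots,g_1^{-1})$; (2) for such $g$, $\Delta(g_i\cdots g_j)=(g_i,\ldots,g_j)$ for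 $1\le i\le j\le k$; (3) there is a constant $R>0$ such that the following holds for all $g,h\in F$. Let $(\underline{c}_1^{-1})$ be the common sequence of $\Delta(g)$ and $\Delta(gh)$, $(\underline{c}_2^{-1})$ that of $\Delta(g^{-1})$ and $\Delta(h)$, and $(\underline{c}_3^{-1})$ that of $\Delta(h^{-1})$ and $\Delta(h^{-1}g^{-1})$. Then there are $(\underline{r}_1),(\underline{r}_2),(\underline{r}_3)\in\mathcal{P}^*$ with $\Delta(g)=(\underline{c}_1^{-1})\cdot(\underline{r}_1)\cdot(\underline{c}_2)$, $\Delta(h)=(\underline{c}_2^{-1})\cdot(\underline{r}_2)\cdot(\underline{c}_3)$, $\Delta(h^{-1}g^{-1})=(\underline{c}_3^{-1})\cdot(\underline{r}_3)\cdot(\underline{c}_1)$; the requirement is that the lengths of $(\underline{r}_1),(\underline{r}_2),(\underline{r}_3)$ are at most $R$. The $(\underline{c}_j)$ and $(\underline{r}_j)$ are called the $c$-part and $r$-part of the $\Delta$-triangle of $(g,h)$. $\Delta$-decomposable. Let $\lambda\colon\mathcal{P}\to\mathbb{R}$ be bounded with $\lambda(p^{-1})=-\lambda(p)$. The map $\phi_{\lambda,\Delta}(g)=\sum_{j=1}^k\lambda(g_j)$, where $\Delta(g)=(g_1,\ldots,g_k)$, is called a $\Delta$-decomposable quasimorphism. $\Delta$-continuous. For $(g,h),(g',h')\in F^2$ with $\Delta$-triangles $(\underline{c}_j),(\underline{r}_j)$ and $(\underline{c}'_j),(\underline{r}'_j)$, where $(\underline{c}_j)=(c_{j,1},\ldots,c_{j,n_j})$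 and $(\underline{c}'_j)=(c'_{j,1},\ldots,c'_{j,n'_j})$, define $N_\Delta((g,h),(g',h'))$ as follows: it is $\infty$ if $(g,h)=(g',h')$; it is $0$ if $(\underline{r}_j)\neq(\underline{r}'_j)$ for some $j\in\{1,2,3\}$; otherwise it is the largest integer $N$ such that, for every $j\in\{1,2,3\}$ with $(\underline{c}_j)\neq(\underline{c}'_j)$, one has $N\le\min\{n_j,n'_j\}$ and $c_{j,k}=c'_{j,k}$ for all $k\le N$. A quasimorphism $\psi$ is $\Delta$-continuous if it is symmetric and there is a non-negative summable sequence $(s_j)_{j\ge 0}$ such that, with $\omega=\delta^1\psi$, for all $(g,h)\neq(g',h')$ in $F^2$, $|\omega(g,h)-\omega(g',h')|\le s_N$ where $N=N_\Delta((g,h),(g',h'))$. In this case the (bounded, symmetric) cocycle $\omega=\delta^1\psi$ is also called $\Delta$-continuous; a symmetric $\Delta$-continuous $2$-cocycle is one of this form. Common $2$-path. For $g,h\in F$ there are unique $t_1,t_2,d\in F$ such that $g=t_1^{-1}d$, $h=d^{-1}t_2$ and $gh=t_1^{-1}t_2$ as reduced words ($t_1,t_2,d$ are the legs of the tripod with endpoints $1,g,gh$ in the Cayley graph of $F$); $d$ is the common $2$-path of $(g,h)$. *)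

theory Defs
  imports Complex_Main "HOL-Library.Sublist" "HOL-Library.Extended_Nat"
begin

section \<open>Free groups\<close>

text \<open>
  The free group with free generating set \<open>'a\<close> (of arbitrary rank) is modelled by the reduced words
  over the letters \<open>(x, True)\<close>, standing for the generator \<open>x\<close>, and \<open>(x, False)\<close>, standing for
  its inverse. Since a type is never empty, only the free group of rank 0 is not of this form.
\<close>

type_synonym 'a letter = "'a \<times> bool"

definition inv_letter :: "'a letter \<Rightarrow> 'a letter" where
  "inv_letter a = (fst a, \<not> snd a)"

lemma inv_letter_inv_letter [simp]: "inv_letter (inv_letter a) = a"
  by (simp add: inv_letter_def)

definition reduced :: "'a letter list \<Rightarrow> bool" where
  "reduced w \<longleftrightarrow> successively (\<lambda>a b. b \<noteq> inv_letter a) w"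

fun push :: "'a letter \<Rightarrow> 'a letter list \<Rightarrow> 'a letter list" where
  "push a [] = [a]"
| "push a (b # w) = (if b = inv_letter a then w else a # b # w)"

definition reduce :: "'a letter list \<Rightarrow> 'a letter list" where
  "reduce w = foldr push w []"

lemma reduced_Nil [simp]: "reduced []"
  by (simp add: reduced_def)

lemma reduced_Cons: "reduced (a # w) \<longleftrightarrow> w = [] \<or> hd w \<noteq> inv_letter a \<and> reduced w"
  by (auto simp: reduced_def successively_Cons)

lemma reduced_push: "reduced w \<Longrightarrow> reduced (push a w)"
  by (cases w) (auto simp: reduced_Cons)

lemma reduced_foldr_push: "reduced v \<Longrightarrow> reduced (foldr push w v)"
  by (induction w) (auto intro: reduced_push)

lemma reduced_reduce: "reduced (reduce w)"
  by (simp add: reduce_def reduced_foldr_push)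

lemma reduce_id: "reduced w \<Longrightarrow> reduce w = w"
proof (induction w)
  case (Cons a w)
  then show ?case by (cases w) (auto simp: reduce_def reduced_Cons)
qed (simp add: reduce_def)

lemma push_inv: "reduced w \<Longrightarrow> push a (push (inv_letter a) w) = w"
proof (cases w)
  case (Cons b v)
  then show "reduced w \<Longrightarrow> ?thesis" by (cases v) (auto simp: reduced_Cons)
qed auto

lemma foldr_push_reduce: "reduced v \<Longrightarrow> foldr push (reduce w) v = foldr push w v"
proof (induction w)
  case (Cons a w)
  have *: "foldr push (push a u) v = push a (foldr push u v)" if "reduced u" for u
  proof (cases u)
    case (Cons b t)
    then show ?thesis
      using push_inv[of "foldr push t v" a] reduced_foldr_push[OF Cons.prems] \<open>reduced v\<close>
      by (auto simp: reduced_foldr_push)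
  qed simp
  show ?case
    using *[OF reduced_reduce[of w]] Cons by (simp add: reduce_def)
qed (simp add: reduce_def)

lemma reduce_append_reduce_left: "reduce (reduce u @ v) = reduce (u @ v)"
  using foldr_push_reduce[OF reduced_reduce[of v], of u] by (simp add: reduce_def)

lemma reduce_append_reduce_right: "reduce (u @ reduce v) = reduce (u @ v)"
  using foldr_push_reduce[of "[]" v] by (simp add: reduce_def)

definition inv_word :: "'a letter list \<Rightarrow> 'a letter list" where
  "inv_word w = rev (map inv_letter w)"

lemma inv_word_inv_word [simp]: "inv_word (inv_word w) = w"
  by (simp add: inv_word_def rev_map comp_def)

lemma reduced_inv_word: "reduced w \<Longrightarrow> reduced (inv_word w)"
  unfolding reduced_def inv_word_def
  by (auto simp: successively_map elim!: successively_mono)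

lemma reduce_inv_word_append: "reduce (inv_word w @ w) = []"
proof -
  have "reduce (inv_word w @ w @ v) = v" if "reduced v" for v
    using that
  proof (induction w arbitrary: v)
    case (Cons a w)
    have r: "reduced (foldr push w v)" using Cons.prems by (rule reduced_foldr_push)
    have "reduce (inv_word (a # w) @ (a # w) @ v)
        = reduce (inv_word w @ reduce (inv_letter a # a # w @ v))"
      by (simp add: inv_word_def reduce_append_reduce_right)
    also have "reduce (inv_letter a # a # w @ v) = reduce (w @ v)"
      using push_inv[OF reduced_reduce[of "w @ v"], of "inv_letter a"] by (simp add: reduce_def)
    finally show ?case using Cons by (simp add: reduce_append_reduce_right)
  qed (simp add: inv_word_def reduce_id)
  from this[of "[]"] show ?thesis by simp
qed

typedef 'a free_group = "{w :: 'a letter list. reduced w}"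
  morphisms word of_word
  by (rule exI[of _ "[]"]) simp

setup_lifting type_definition_free_group

instantiation free_group :: (type) "{monoid_mult, inverse}"
begin

lift_definition one_free_group :: "'a free_group" is "[]" by simp

lift_definition times_free_group :: "'a free_group \<Rightarrow> 'a free_group \<Rightarrow> 'a free_group"
  is "\<lambda>u v. reduce (u @ v)" by (rule reduced_reduce)

lift_definition inverse_free_group :: "'a free_group \<Rightarrow> 'a free_group"
  is inv_word by (rule reduced_inv_word)

definition divide_free_group :: "'a free_group \<Rightarrow> 'a free_group \<Rightarrow> 'a free_group" where
  "divide_free_group g h = g * inverse h"

instance
proof
  fix a b c :: "'a free_group"
  show "a * b * c = a * (b * c)"
    by transfer (simp add: reduce_append_reduce_left reduce_append_reduce_right)
  show "1 * a = a" by transfer (simp add: reduce_id)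
  show "a * 1 = a" by transfer (simp add: reduce_id)
qed

end

lemma free_group_left_inverse: "inverse g * g = (1 :: 'a free_group)"
  by transfer (rule reduce_inv_word_append)

interpretation free_group: group "(*) :: 'a free_group \<Rightarrow> 'a free_group \<Rightarrow> 'a free_group" 1 inverse
  by standard (simp_all add: free_group_left_inverse mult.assoc)

text \<open>\<open>g\<close> is the product of \<open>gs\<close>, and this product is reduced (no cancellation).\<close>

definition reduced_product :: "'a free_group \<Rightarrow> 'a free_group list \<Rightarrow> bool" where
  "reduced_product g gs \<longleftrightarrow> g = prod_list gs \<and> reduced (concat (map word gs))"

text \<open>The unique leg \<open>d\<close> of the tripod with endpoints \<open>1\<close>, \<open>g\<close>, \<open>g * h\<close>.\<close>

definition common_2path :: "'a free_group \<Rightarrow> 'a free_group \<Rightarrow> 'a free_group" where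
  "common_2path g h = (THE d. \<exists>t1 t2.
     reduced_product g [inverse t1, d] \<and>
     reduced_product h [inverse d, t2] \<and>
     reduced_product (g * h) [inverse t1, t2])"


section \<open>Cochains and quasimorphisms\<close>

definition \<delta>1 :: "('a free_group \<Rightarrow> real) \<Rightarrow> 'a free_group \<Rightarrow> 'a free_group \<Rightarrow> real" where
  "\<delta>1 \<alpha> g h = \<alpha> g - \<alpha> (g * h) + \<alpha> h"

definition \<delta>2 :: "('a free_group \<Rightarrow> 'a free_group \<Rightarrow> real) \<Rightarrow>
    'a free_group \<Rightarrow> 'a free_group \<Rightarrow> 'a free_group \<Rightarrow> real" where
  "\<delta>2 \<alpha> g h i = \<alpha> h i - \<alpha> (g * h) i + \<alpha> g (h * i) - \<alpha> g h"

definition quasimorphism :: "('a free_group \<Rightarrow> real) \<Rightarrow> bool" where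
  "quasimorphism \<alpha> \<longleftrightarrow> (\<exists>B. \<forall>g h. \<bar>\<delta>1 \<alpha> g h\<bar> \<le> B)"

definition symmetric_map :: "('a free_group \<Rightarrow> real) \<Rightarrow> bool" where
  "symmetric_map \<alpha> \<longleftrightarrow> (\<forall>g. \<alpha> (inverse g) = - \<alpha> g)"

definition bounded_3cochain ::
    "('a free_group \<Rightarrow> 'a free_group \<Rightarrow> 'a free_group \<Rightarrow> real) \<Rightarrow> bool" where
  "bounded_3cochain \<beta> \<longleftrightarrow> (\<exists>B. \<forall>g h i. \<bar>\<beta> g h i\<bar> \<le> B)"


section \<open>Decompositions\<close>

definition inv_seq :: "'a free_group list \<Rightarrow> 'a free_group list" where
  "inv_seq gs = rev (map inverse gs)"

definition common_seq :: "'b list \<Rightarrow> 'b list \<Rightarrow> 'b list" where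
  "common_seq xs ys = Longest_common_prefix {xs, ys}"

text \<open>
  The \<open>c\<close>-part and the \<open>r\<close>-part of a triangle are lists of three sequences, so the sequence with
  index \<open>j \<in> {1,2,3}\<close> sits at list position \<open>j - 1\<close>. The common sequences themselves are the
  inverses of the sequences in the \<open>c\<close>-part. Each \<open>r\<close>-sequence is determined by the equation it
  satisfies; it is a sequence of pieces because the left-hand side is one.
\<close>

definition c_part ::
    "('a free_group \<Rightarrow> 'a free_group list) \<Rightarrow> 'a free_group \<Rightarrow> 'a free_group \<Rightarrow> 'a free_group list list"
  where
  "c_part \<Delta> g h =
    [inv_seq (common_seq (\<Delta> g) (\<Delta> (g * h))),
     inv_seq (common_seq (\<Delta> (inverse g)) (\<Delta> h)),
     inv_seq (common_seq (\<Delta> (inverse h)) (\<Delta> (inverse h * inverse g)))]"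

definition is_r_part ::
    "('a free_group \<Rightarrow> 'a free_group list) \<Rightarrow> 'a free_group \<Rightarrow> 'a free_group \<Rightarrow>
      'a free_group list list \<Rightarrow> bool" where
  "is_r_part \<Delta> g h rs \<longleftrightarrow> (\<exists>c1 c2 c3 r1 r2 r3.
     c_part \<Delta> g h = [c1, c2, c3] \<and> rs = [r1, r2, r3] \<and>
     \<Delta> g = inv_seq c1 @ r1 @ c2 \<and>
     \<Delta> h = inv_seq c2 @ r2 @ c3 \<and>
     \<Delta> (inverse h * inverse g) = inv_seq c3 @ r3 @ c1)"

definition r_part ::
    "('a free_group \<Rightarrow> 'a free_group list) \<Rightarrow> 'a free_group \<Rightarrow> 'a free_group \<Rightarrow> 'a free_group list list"
  where
  "r_part \<Delta> g h = (THE rs. is_r_part \<Delta> g h rs)"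

definition decomposition ::
    "'a free_group set \<Rightarrow> ('a free_group \<Rightarrow> 'a free_group list) \<Rightarrow> bool" where
  "decomposition \<P> \<Delta> \<longleftrightarrow>
     (\<forall>p\<in>\<P>. inverse p \<in> \<P>) \<and> 1 \<notin> \<P> \<and>
     (\<forall>g. \<Delta> g \<in> lists \<P>) \<and>
     (\<forall>g. reduced_product g (\<Delta> g) \<and> \<Delta> (inverse g) = inv_seq (\<Delta> g)) \<and>
     (\<forall>g gs. sublist gs (\<Delta> g) \<and> gs \<noteq> [] \<longrightarrow> \<Delta> (prod_list gs) = gs) \<and>
     (\<exists>R::real. R > 0 \<and>
       (\<forall>g h. \<exists>rs. is_r_part \<Delta> g h rs \<and> (\<forall>r\<in>set rs. real (length r) \<le> R)))"

definition decomposable ::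
    "'a free_group set \<Rightarrow> ('a free_group \<Rightarrow> 'a free_group list) \<Rightarrow> ('a free_group \<Rightarrow> real) \<Rightarrow> bool" where
  "decomposable \<P> \<Delta> \<phi> \<longleftrightarrow>
     (\<exists>l. (\<exists>B. \<forall>p\<in>\<P>. \<bar>l p\<bar> \<le> B) \<and> (\<forall>p\<in>\<P>. l (inverse p) = - l p) \<and>
          (\<forall>g. \<phi> g = sum_list (map l (\<Delta> g))))"


section \<open>Continuity\<close>

text \<open>
  The constraint below always admits \<open>N = 0\<close>, so the largest such integer is a natural number. When
  \<open>\<Delta>\<close> is a decomposition and the two pairs differ but have equal \<open>r\<close>-parts, some of their
  \<open>c\<close>-sequences differ, so that the largest such number exists.
\<close>

definition triangle_agreement ::
    "('a free_group \<Rightarrow> 'a free_group list) \<Rightarrow> 'a free_group \<times> 'a free_group \<Rightarrow>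
      'a free_group \<times> 'a free_group \<Rightarrow> enat" where
  "triangle_agreement \<Delta> x y =
    (let cx = c_part \<Delta> (fst x) (snd x); cy = c_part \<Delta> (fst y) (snd y) in
     if x = y then \<infinity>
     else if r_part \<Delta> (fst x) (snd x) \<noteq> r_part \<Delta> (fst y) (snd y) then 0
     else enat (GREATEST N. \<forall>j<3. cx ! j \<noteq> cy ! j \<longrightarrow>
            N \<le> min (length (cx ! j)) (length (cy ! j)) \<and>
            (\<forall>k<N. cx ! j ! k = cy ! j ! k)))"

definition delta_continuous ::
    "('a free_group \<Rightarrow> 'a free_group list) \<Rightarrow> ('a free_group \<Rightarrow> real) \<Rightarrow> bool" where
  "delta_continuous \<Delta> \<psi> \<longleftrightarrow>
     quasimorphism \<psi> \<and> symmetric_map \<psi> \<and>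
     (\<exists>s :: nat \<Rightarrow> real. (\<forall>j. s j \<ge> 0) \<and> summable s \<and>
       (\<forall>g h g' h'. (g, h) \<noteq> (g', h') \<longrightarrow>
          \<bar>\<delta>1 \<psi> g h - \<delta>1 \<psi> g' h'\<bar> \<le> s (the_enat (triangle_agreement \<Delta> (g, h) (g', h')))))"

definition delta_continuous_cocycle ::
    "('a free_group \<Rightarrow> 'a free_group list) \<Rightarrow> ('a free_group \<Rightarrow> 'a free_group \<Rightarrow> real) \<Rightarrow> bool" where
  "delta_continuous_cocycle \<Delta> \<omega> \<longleftrightarrow> (\<exists>\<psi>. delta_continuous \<Delta> \<psi> \<and> \<omega> = \<delta>1 \<psi>)"

end

theory Submission
  imports Defs
begin

text \<open>
  Put \<open>x = 1\<close>, \<open>y = g\<close>, \<open>z = g * h\<close>, \<open>w = g * h * i\<close>. The \<open>\<Delta>\<close>-path between two points is read as a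
  set of edges. An edge \<open>e = (p, q)\<close> contributes \<open>\<phi> (p\<inverse> q)\<close> times the value of the homogeneous
  alternating cocycle at \<open>(q, p, v)\<close>; both factors change sign with the orientation, and by continuity
  the dependence on \<open>v\<close> is, up to a summable error, only on the side of \<open>e\<close> on which \<open>v\<close> lies. Up to
  boundedly many edges, the edge sets of the sides of a triangle sum to zero modulo 2, as in a tree.
  Up to a bounded error, the cocycle identity turns twice \<open>\<phi> \<cup> \<omega> + \<delta>2 \<eta>\<close> into a sum of differences
  of contributions over the edges common to \<open>[x,y]\<close> and \<open>[y,z]\<close>, and \<open>4 \<gamma>\<close> is a sum of the same
  kind. For an edge obeying the parity rule for \<open>x, y, z, w\<close>, the total contribution to \<open>4 \<beta>\<close> is a
  difference of contributions at two points on the same side of the edge, and these differences are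
  absolutely summable.
\<close>

section \<open>Words\<close>

lemma reduced_append:
  "reduced (u @ v) \<longleftrightarrow>
     reduced u \<and> reduced v \<and> (u = [] \<or> v = [] \<or> hd v \<noteq> inv_letter (last u))"
  by (auto simp: reduced_def successively_append_iff)

lemma inv_word_append: "inv_word (u @ v) = inv_word v @ inv_word u"
  by (simp add: inv_word_def)

lemma reduced_word: "reduced (word g)"
  using word[of g] by simp

lemma word_of_word: "reduced w \<Longrightarrow> word (of_word w) = w"
  by (simp add: of_word_inverse)

lemma word_prod_list:
  "reduced (concat (map word gs)) \<Longrightarrow> word (prod_list gs) = concat (map word gs)"
  by (induction gs) (auto simp: one_free_group.rep_eq times_free_group.rep_eq reduced_append reduce_id)

lemma reduced_product_iff:
  "reduced_product g gs \<longleftrightarrow> word g = concat (map word gs)"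
  unfolding reduced_product_def
  using word_prod_list[of gs] reduced_word[of g] by (metis word_inject)

text \<open>The condition on the two remainders after a longest common prefix is split off:
  maximality means that they do not both continue with the same entry.\<close>

definition diverging :: "'b list \<Rightarrow> 'b list \<Rightarrow> bool" where
  "diverging xs ys \<longleftrightarrow> xs = [] \<or> ys = [] \<or> hd xs \<noteq> hd ys"

text \<open>If one prefix were longer, both remainders of the shorter one would start with the same
  entry.\<close>

lemma diverging_unique:
  assumes "c @ a = c' @ a'" "c @ b = c' @ b'" "diverging a b" "diverging a' b'"
  shows "c = c'"
proof -
  obtain us where "c = c' @ us \<and> us @ a = a' \<or> c @ us = c' \<and> a = us @ a'"
    using assms(1) by (auto simp: append_eq_append_conv2)
  then show ?thesis
    using assms(2-4) by (cases us) (auto simp: diverging_def)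
qed

lemma common_seq_append:
  assumes "diverging a b"
  shows "common_seq (c @ a) (c @ b) = c"
proof (induction c)
  case Nil
  then show ?case
    using assms
    by (cases a; cases b)
       (auto simp: common_seq_def diverging_def Longest_common_prefix_Nil
         intro!: Longest_common_prefix_eq_Nil[of "hd a" "tl a" _ "hd b" "tl b"])
next
  case (Cons x c)
  then show ?case
    using Longest_common_prefix_image_Cons[of "{c @ a, c @ b}" x]
    by (simp add: common_seq_def)
qed

lemma common_seqE:
  obtains a b where "xs = common_seq xs ys @ a" "ys = common_seq xs ys @ b" "diverging a b"
proof -
  have "\<exists>c a b. xs = c @ a \<and> ys = c @ b \<and> diverging a b"
  proof (induction xs ys rule: list_induct2')
    case (4 x xs y ys)
    show ?case
    proof (cases "x = y")
      case True
      then show ?thesis using 4 by (metis append_Cons)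
    next
      case False
      then have "x # xs = [] @ (x # xs) \<and> y # ys = [] @ (y # ys) \<and> diverging (x # xs) (y # ys)"
        by (simp add: diverging_def)
      then show ?thesis by blast
    qed
  qed (auto simp: diverging_def)
  then show ?thesis
    using that common_seq_append by metis
qed

lemma common_seq_commute: "common_seq xs ys = common_seq ys xs"
  by (simp add: common_seq_def insert_commute)

section \<open>Cancellation between words and the common 2-path\<close>

lemma last_inv_word: "w \<noteq> [] \<Longrightarrow> last (inv_word w) = inv_letter (hd w)"
  by (cases w) (auto simp: inv_word_def)

lemma inv_word_Nil_iff [simp]: "inv_word w = [] \<longleftrightarrow> w = []"
  by (simp add: inv_word_def)

text \<open>Cancellation can only start at the junction, where the inverse of the first letter of
  \<open>u\<close> meets the first letter of \<open>v\<close>.\<close>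

lemma inverse_letters_diverge:
  assumes "reduced u" "reduced v"
  shows "reduced (inv_word u @ v) \<longleftrightarrow> diverging u v"
  using assms
  by (auto simp: reduced_append reduced_inv_word last_inv_word diverging_def)

text \<open>The word of \<open>inverse d\<close> has to be the longest common prefix of the words of
  \<open>inverse g\<close> and \<open>h\<close>; this gives the witness, and uniqueness of that
  prefix gives uniqueness of \<open>d\<close>.\<close>

lemma ex1_common_2path:
  "\<exists>!d. \<exists>t1 t2. reduced_product g [inverse t1, d] \<and> reduced_product h [inverse d, t2] \<and>
     reduced_product (g * h) [inverse t1, t2]"
proof (rule ex_ex1I)
  define c where "c = common_seq (word (inverse g)) (word h)"
  obtain a b where a: "word (inverse g) = c @ a" and b: "word h = c @ b"
    and ab: "diverging a b"
    unfolding c_def by (rule common_seqE)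
  have red: "reduced c" "reduced a" "reduced b"
    using reduced_word[of "inverse g"] reduced_word[of h] by (auto simp: a b reduced_append)
  define d t1 t2 where "d = inverse (of_word c)" and "t1 = of_word a" and "t2 = of_word b"
  have w: "word d = inv_word c" "word (inverse t1) = inv_word a" "word t2 = b"
    "word (inverse d) = c"
    using red by (simp_all add: d_def t1_def t2_def inverse_free_group.rep_eq word_of_word)
  have g: "word g = inv_word a @ inv_word c"
    by (metis a inv_word_append inv_word_inv_word inverse_free_group.rep_eq)
  then have 1: "reduced_product g [inverse t1, d]" by (simp add: reduced_product_iff w)
  have 2: "reduced_product h [inverse d, t2]" by (simp add: reduced_product_iff w b)
  have "g * h = inverse t1 * t2"
    using 1 2 by (simp add: reduced_product_def mult.assoc)
      (metis free_group.right_inverse mult.assoc mult_1)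
  then have "reduced_product (g * h) [inverse t1, t2]"
    using ab red by (simp add: reduced_product_def w inverse_letters_diverge)
  then show "\<exists>d t1 t2. reduced_product g [inverse t1, d] \<and> reduced_product h [inverse d, t2] \<and>
     reduced_product (g * h) [inverse t1, t2]"
    using 1 2 by blast
next
  have *: "\<exists>a b. word (inverse g) = word (inverse d) @ a \<and> word h = word (inverse d) @ b \<and> diverging a b"
    if "\<exists>t1 t2. reduced_product g [inverse t1, d] \<and> reduced_product h [inverse d, t2] \<and>
     reduced_product (g * h) [inverse t1, t2]" (is ?ex) for d
  proof -
    obtain t1 t2 where t: "reduced_product g [inverse t1, d]" "reduced_product h [inverse d, t2]"
       "reduced_product (g * h) [inverse t1, t2]" using \<open>?ex\<close> by blast
    then have "reduced (inv_word (word t1) @ word t2)"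
      by (simp add: reduced_product_def inverse_free_group.rep_eq)
    then have "diverging (word t1) (word t2)"
      by (simp add: inverse_letters_diverge reduced_word)
    then show ?thesis
      using t(1,2) by (auto simp: reduced_product_iff inverse_free_group.rep_eq inv_word_append)
  qed
  fix d d'
  assume "\<exists>t1 t2. reduced_product g [inverse t1, d] \<and> reduced_product h [inverse d, t2] \<and>
     reduced_product (g * h) [inverse t1, t2]"
    and "\<exists>t1 t2. reduced_product g [inverse t1, d'] \<and> reduced_product h [inverse d', t2] \<and>
     reduced_product (g * h) [inverse t1, t2]"
  from *[OF this(1)] *[OF this(2)] have "word (inverse d) = word (inverse d')"
    by (metis diverging_unique)
  then show "d = d'"
    by (metis free_group.inverse_inverse word_inject)
qed

lemmas common_2path = theI'[OF ex1_common_2path, folded common_2path_def]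


section \<open>Edge paths\<close>

lemma inverse_mult_cancel [simp]:
  fixes a b :: "'a free_group"
  shows "inverse a * (a * b) = b" "a * (inverse a * b) = b"
  by (simp_all flip: mult.assoc)

lemmas inverse_mult = free_group.inverse_distrib_swap

lemma prod_list_inv_seq: "prod_list (inv_seq gs) = inverse (prod_list gs)"
  by (induction gs) (simp_all add: inv_seq_def inverse_mult)

lemma inv_seq_inv_seq [simp]: "inv_seq (inv_seq gs) = gs"
  by (simp add: inv_seq_def rev_map comp_def)

text \<open>A sequence of pieces becomes a path of oriented edges in the Cayley graph with respect
  to the pieces.\<close>

primrec edge_path ::
    "'a free_group \<Rightarrow> 'a free_group list \<Rightarrow> ('a free_group \<times> 'a free_group) list" where
  "edge_path x [] = []"
| "edge_path x (g # gs) = (x, x * g) # edge_path (x * g) gs"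

definition reverse_path :: "('b \<times> 'b) list \<Rightarrow> ('b \<times> 'b) list" where
  "reverse_path es = rev (map prod.swap es)"

lemma reverse_path_simps [simp]:
  "reverse_path (es @ es') = reverse_path es' @ reverse_path es"
  "reverse_path (reverse_path es) = es"
  "set (reverse_path es) = prod.swap ` set es"
  "length (reverse_path es) = length es"
  by (simp_all add: reverse_path_def rev_map comp_def)

lemma edge_path_append:
  "edge_path x (gs @ hs) = edge_path x gs @ edge_path (x * prod_list gs) hs"
  by (induction gs arbitrary: x) (simp_all add: mult.assoc)

lemma edge_path_inv_seq:
  "edge_path (x * prod_list gs) (inv_seq gs) = reverse_path (edge_path x gs)"
proof (induction gs arbitrary: x)
  case Nil
  show ?case by (simp add: inv_seq_def reverse_path_def)
next
  case (Cons g gs)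
  have "inv_seq (g # gs) = inv_seq gs @ [inverse g]" by (simp add: inv_seq_def)
  then show ?case
    using Cons[of "x * g"]
    by (simp add: edge_path_append mult.assoc prod_list_inv_seq)
       (simp add: reverse_path_def)
qed

lemma length_edge_path [simp]: "length (edge_path x gs) = length gs"
  by (induction gs arbitrary: x) simp_all

lemma edge_pathE:
  assumes "(p, q) \<in> set (edge_path x gs)"
  obtains us g vs where "gs = us @ g # vs" "p = x * prod_list us" "q = x * prod_list (us @ [g])"
  using assms
proof (induction gs arbitrary: x thesis)
  case (Cons g gs)
  show ?case
  proof (cases "(p, q) = (x, x * g)")
    case True
    then show ?thesis using Cons.prems(1)[of "[]" g gs] by simp
  next
    case False
    then have "(p, q) \<in> set (edge_path (x * g) gs)" using Cons.prems(2) by auto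
    then obtain us g' vs where "gs = us @ g' # vs" "p = x * g * prod_list us"
      "q = x * g * prod_list (us @ [g'])"
      by (rule Cons.IH[rotated])
    then show ?thesis using Cons.prems(1)[of "g # us" g' vs] by (simp add: mult.assoc)
  qed
qed simp


section \<open>Triangles\<close>

locale free_group_decomposition =
  fixes \<P> :: "'a free_group set"
    and \<Delta> :: "'a free_group \<Rightarrow> 'a free_group list"
    and R :: real
  assumes decomposition: "decomposition \<P> \<Delta>"
    and r_part_bound: "\<exists>rs. is_r_part \<Delta> g h rs \<and> (\<forall>r\<in>set rs. real (length r) \<le> R)"
begin

lemma pieces: "set (\<Delta> g) \<subseteq> \<P>"
  and one_not_piece: "1 \<notin> \<P>"
  and reduced_product_\<Delta>: "reduced_product g (\<Delta> g)"
  and \<Delta>_inverse: "\<Delta> (inverse g) = inv_seq (\<Delta> g)"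
  using decomposition by (auto simp: decomposition_def)

lemma prod_list_\<Delta> [simp]: "prod_list (\<Delta> g) = g"
  using reduced_product_\<Delta>[of g] by (simp add: reduced_product_def)

lemma word_\<Delta>: "word g = concat (map word (\<Delta> g))"
  using reduced_product_\<Delta>[of g] by (simp add: reduced_product_iff)

lemma word_piece: "p \<in> \<P> \<Longrightarrow> word p \<noteq> []"
  using one_not_piece by (metis one_free_group.rep_eq word_inject)

lemma \<Delta>_one [simp]: "\<Delta> 1 = []"
  using word_\<Delta>[of 1] word_piece pieces[of 1]
  by (cases "\<Delta> 1") (auto simp: one_free_group.rep_eq)

lemma \<Delta>_prod_list: "sublist gs (\<Delta> g) \<Longrightarrow> \<Delta> (prod_list gs) = gs"
  using decomposition by (cases "gs = []") (auto simp: decomposition_def)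

lemma \<Delta>_prefix: "\<Delta> g = us @ vs \<Longrightarrow> \<Delta> (prod_list us) = us"
  by (rule \<Delta>_prod_list[of _ g]) simp

lemma \<Delta>_suffix: "\<Delta> g = us @ vs \<Longrightarrow> \<Delta> (prod_list vs) = vs"
  by (rule \<Delta>_prod_list[of _ g]) simp

definition path :: "'a free_group \<Rightarrow> 'a free_group \<Rightarrow> ('a free_group \<times> 'a free_group) list" where
  "path x y = edge_path x (\<Delta> (inverse x * y))"

definition leg ::
    "'a free_group \<Rightarrow> 'a free_group \<Rightarrow> 'a free_group \<Rightarrow> ('a free_group \<times> 'a free_group) list" where
  "leg x y z = edge_path x (common_seq (\<Delta> (inverse x * y)) (\<Delta> (inverse x * z)))"

lemma leg_commute: "leg x y z = leg x z y"
  by (simp add: leg_def common_seq_commute)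

lemma path_reverse: "path y x = reverse_path (path x y)"
  using edge_path_inv_seq[of x "\<Delta> (inverse x * y)"] \<Delta>_inverse[of "inverse x * y"]
  by (simp add: path_def inverse_mult mult.assoc)

text \<open>Only the first equation of the \<open>\<Delta>\<close>-triangle of
  \<open>inverse x * y\<close> and \<open>inverse y * z\<close> is read off; permuting the vertices
  yields the other sides.\<close>

lemma path_decomp:
  "\<exists>r. path x y = leg x y z @ r @ reverse_path (leg y x z) \<and> real (length r) \<le> R"
proof -
  let ?g = "inverse x * y" and ?h = "inverse y * z"
  obtain rs where "is_r_part \<Delta> ?g ?h rs" "\<forall>r\<in>set rs. real (length r) \<le> R"
    using r_part_bound by blast
  then obtain r1 where 1: "real (length r1) \<le> R"
    and g: "\<Delta> ?g = common_seq (\<Delta> ?g) (\<Delta> (?g * ?h)) @ r1 @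
      inv_seq (common_seq (\<Delta> (inverse ?g)) (\<Delta> ?h))"
    by (auto simp: is_r_part_def c_part_def)
  define c1 where "c1 = common_seq (\<Delta> ?g) (\<Delta> (?g * ?h))"
  define c2 where "c2 = common_seq (\<Delta> (inverse ?g)) (\<Delta> ?h)"
  have g': "\<Delta> ?g = c1 @ r1 @ inv_seq c2"
    using g by (simp only: c1_def c2_def)
  have "x * prod_list (\<Delta> ?g) = y" by simp
  \<comment> \<open>Both sides are the vertex where the leg at \<open>y\<close> ends, so the last
    stretch of the path is that leg traversed backwards.\<close>
  then have "x * prod_list c1 * prod_list r1 = y * prod_list c2"
    unfolding g' by (simp add: prod_list_inv_seq mult.assoc)
      (metis (no_types, opaque_lifting) free_group.left_inverse mult.assoc mult.right_neutral)
  then have "path x y = edge_path x c1 @ edge_path (x * prod_list c1) r1 @ reverse_path (edge_path y c2)"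
    unfolding path_def g' by (simp add: edge_path_append edge_path_inv_seq flip: mult.assoc)
  moreover have "edge_path x c1 = leg x y z" "edge_path y c2 = leg y x z"
    by (simp_all add: leg_def c1_def c2_def mult.assoc inverse_mult)
  ultimately show ?thesis using 1 by (metis length_edge_path)
qed

text \<open>Prefixes of \<open>\<Delta> g\<close> are their own decompositions, so the number of
  pieces from \<open>x\<close> is a height along the path. Hence no edge is traversed in both
  directions.\<close>

lemma path_height:
  assumes "(p, q) \<in> set (path x y)"
  shows "length (\<Delta> (inverse x * q)) = Suc (length (\<Delta> (inverse x * p)))"
proof -
  obtain us g vs where "\<Delta> (inverse x * y) = us @ g # vs" "p = x * prod_list us"
    "q = x * prod_list (us @ [g])"
    using assms unfolding path_def by (rule edge_pathE)
  moreover from this(1) have "\<Delta> (prod_list us) = us" "\<Delta> (prod_list (us @ [g])) = us @ [g]"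
    by (auto intro: \<Delta>_prefix[where vs = "g # vs"] \<Delta>_prefix[where vs = vs] simp del: prod_list.append)
  ultimately show ?thesis by (simp del: prod_list.append)
qed

lemma path_piece: "(p, q) \<in> set (path x y) \<Longrightarrow> inverse p * q \<in> \<P>"
  unfolding path_def using pieces[of "inverse x * y"]
  by (auto elim!: edge_pathE simp: inverse_mult mult.assoc)

lemma path_swap_disjoint: "set (path x y) \<inter> prod.swap ` set (path x y) = {}"
  by (fastforce dest: path_height)

text \<open>\<open>\<Delta>\<close> recovers a prefix from its product, so a vertex of the path
  determines the prefix leading to it, and no two edges have the same start.\<close>

lemma distinct_path: "distinct (path x y)"
proof -
  have *: "distinct (edge_path x gs)" if "\<Delta> (prod_list gs) = gs" for gs
    using that
  proof (induction gs rule: rev_induct)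
    case (snoc g gs)
    have gs: "\<Delta> (prod_list gs) = gs"
      by (rule \<Delta>_prefix[OF snoc.prems])
    let ?e = "(x * prod_list gs, x * prod_list gs * g)"
    have "?e \<notin> set (edge_path x gs)"
    proof
      assume "?e \<in> set (edge_path x gs)"
      then obtain us h vs where us: "gs = us @ h # vs" "x * prod_list gs = x * prod_list us"
        by (rule edge_pathE)
      then have "prod_list gs = prod_list us" by (metis inverse_mult_cancel(1))
      moreover have "\<Delta> (prod_list us) = us" using gs us(1) by (metis \<Delta>_prefix)
      ultimately show False using gs us(1) by simp
    qed
    then show ?case using snoc.IH[OF gs] by (simp add: edge_path_append)
  qed simp
  show ?thesis unfolding path_def by (rule *) simp
qed

section \<open>Unoriented edge sets and their parity on triangles\<close>

definition edges :: "'a free_group \<Rightarrow> 'a free_group \<Rightarrow> ('a free_group \<times> 'a free_group) set" where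
  "edges x y = set (path x y) \<union> prod.swap ` set (path x y)"

definition leg_edges ::
    "'a free_group \<Rightarrow> 'a free_group \<Rightarrow> 'a free_group \<Rightarrow> ('a free_group \<times> 'a free_group) set" where
  "leg_edges x y z = set (leg x y z) \<union> prod.swap ` set (leg x y z)"

lemma finite_edges [simp]: "finite (edges x y)"
  by (simp add: edges_def)

lemma edges_commute: "edges x y = edges y x"
  by (auto simp: edges_def path_reverse[of x y])

lemma leg_edges_commute: "leg_edges x y z = leg_edges x z y"
  by (simp add: leg_edges_def leg_commute)

lemma edges_piece: "(p, q) \<in> edges x y \<Longrightarrow> inverse p * q \<in> \<P>"
  using path_piece[of p q x y] path_piece[of p q y x]
  by (auto simp: edges_def path_reverse[of x y])

text \<open>Edges enter with both orientations, hence \<open>2 * R\<close>. The two legs are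
  disjoint, being different stretches of a path that neither repeats nor reverses an edge.\<close>

lemma edges_decomp:
  "\<exists>X. finite X \<and> card X \<le> 2 * R \<and> edges x y = leg_edges x y z \<union> leg_edges y x z \<union> X \<and>
       leg_edges x y z \<inter> leg_edges y x z = {}"
proof -
  obtain r where r: "path x y = leg x y z @ r @ reverse_path (leg y x z)" "real (length r) \<le> R"
    using path_decomp by blast
  let ?X = "set r \<union> prod.swap ` set r"
  have "card ?X \<le> length r + length r"
    by (intro order.trans[OF card_Un_le] add_mono order.trans[OF card_image_le] card_length) simp
  then have "card ?X \<le> 2 * R" using r(2) by linarith
  moreover have "edges x y = leg_edges x y z \<union> leg_edges y x z \<union> ?X"
    by (auto simp: edges_def leg_edges_def r(1))
  moreover have "leg_edges x y z \<inter> leg_edges y x z = {}"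
  proof -
    have 1: "(p, q) \<in> set (leg x y z) \<Longrightarrow> (q, p) \<notin> set (leg y x z)" for p q
      using distinct_path[of x y] by (force simp: r(1))
    have "(p, q) \<in> set (leg x y z) \<Longrightarrow> (p, q) \<notin> set (leg y x z)" for p q
      using path_swap_disjoint[of x y] by (force simp: r(1))
    with 1 show ?thesis by (auto simp: leg_edges_def)
  qed
  ultimately show ?thesis by (intro exI[of _ ?X]) auto
qed

text \<open>Outside a set of bounded size, the edge sets behave as in a tree: an edge lies on an even
  number of sides of a triangle.\<close>

lemma triangle_parity:
  "\<exists>X. finite X \<and> card X \<le> 6 * R \<and>
     (\<forall>e. e \<notin> X \<longrightarrow> (e \<in> edges x z \<longleftrightarrow> (e \<in> edges x y) \<noteq> (e \<in> edges y z)) \<and>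
                    (e \<in> leg_edges y x z \<longleftrightarrow> e \<in> edges x y \<inter> edges y z))"
proof -
  obtain X where X: "finite X" "card X \<le> 2 * R"
    "edges x y = leg_edges x y z \<union> leg_edges y x z \<union> X" "leg_edges x y z \<inter> leg_edges y x z = {}"
    using edges_decomp[of x y z] by blast
  obtain Y where Y: "finite Y" "card Y \<le> 2 * R"
    "edges y z = leg_edges y x z \<union> leg_edges z x y \<union> Y" "leg_edges y x z \<inter> leg_edges z x y = {}"
    using edges_decomp[of y z x] by (metis leg_edges_commute)
  obtain Z where Z: "finite Z" "card Z \<le> 2 * R"
    "edges x z = leg_edges x y z \<union> leg_edges z x y \<union> Z" "leg_edges x y z \<inter> leg_edges z x y = {}"
    using edges_decomp[of x z y] by (metis leg_edges_commute)
  have "card (X \<union> Y \<union> Z) \<le> card X + card Y + card Z"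
    using card_Un_le[of "X \<union> Y" Z] card_Un_le[of X Y] by linarith
  then have "card (X \<union> Y \<union> Z) \<le> 6 * R" using X(2) Y(2) Z(2) by linarith
  \<comment> \<open>Off the exceptional sets each side is the union of two legs, and each leg lies
    on two sides. The three legs are pairwise disjoint, so an edge lies on none or exactly two of
    the sides.\<close>
  moreover have "(e \<in> edges x z \<longleftrightarrow> (e \<in> edges x y) \<noteq> (e \<in> edges y z)) \<and>
      (e \<in> leg_edges y x z \<longleftrightarrow> e \<in> edges x y \<inter> edges y z)" if "e \<notin> X \<union> Y \<union> Z" for e
  proof -
    have "e \<in> edges x y \<longleftrightarrow> e \<in> leg_edges x y z \<or> e \<in> leg_edges y x z"
      "e \<in> edges y z \<longleftrightarrow> e \<in> leg_edges y x z \<or> e \<in> leg_edges z x y"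
      "e \<in> edges x z \<longleftrightarrow> e \<in> leg_edges x y z \<or> e \<in> leg_edges z x y"
      using that X(3) Y(3) Z(3) by blast+
    then show ?thesis using X(4) Y(4) Z(4) by blast
  qed
  ultimately show ?thesis
    using X(1) Y(1) Z(1) by (intro exI[of _ "X \<union> Y \<union> Z"]) blast
qed

text \<open>A common first piece has a nonempty word, so its first letter would cancel at the
  junction of \<open>a\<close> and \<open>b\<close>.\<close>

lemma common_seq_reduced:
  assumes "reduced_product g [a, b]"
  shows "common_seq (\<Delta> (inverse a)) (\<Delta> b) = []"
proof -
  obtain us vs where us: "\<Delta> (inverse a) = common_seq (\<Delta> (inverse a)) (\<Delta> b) @ us"
    and vs: "\<Delta> b = common_seq (\<Delta> (inverse a)) (\<Delta> b) @ vs"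
    by (rule common_seqE)
  show ?thesis
  proof (cases "common_seq (\<Delta> (inverse a)) (\<Delta> b)")
    case (Cons p ps)
    then have "\<Delta> (inverse a) = p # ps @ us" "\<Delta> b = p # ps @ vs" using us vs by simp_all
    then have "word (inverse a) = word p @ concat (map word (ps @ us))"
      "word b = word p @ concat (map word (ps @ vs))" "p \<in> \<P>"
      using word_\<Delta>[of "inverse a"] word_\<Delta>[of b] pieces[of b] by simp_all
    then have "\<not> diverging (word (inverse a)) (word b)"
      using word_piece[of p] by (auto simp: diverging_def)
    moreover have "reduced (inv_word (word (inverse a)) @ word b)"
      using assms by (simp add: reduced_product_def inverse_free_group.rep_eq)
    ultimately show ?thesis
      by (simp add: inverse_letters_diverge reduced_word)
  qed
qed

text \<open>Used at the centre of a tripod: segments meeting there without cancellation share no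
  initial edges.\<close>

lemma leg_reduced:
  "reduced_product g [inverse m * x, inverse x * y] \<Longrightarrow> leg x m y = []"
  using common_seq_reduced[of g "inverse m * x" "inverse x * y"]
  by (simp add: leg_def inverse_mult)

end


text \<open>The counting scheme behind all error terms: each exceptional edge in \<open>X\<close>
  costs \<open>M\<close>, and \<open>Q\<close> controls the others.\<close>

lemma abs_sum_le_exceptional:
  fixes T Q :: "'b \<Rightarrow> real"
  assumes U: "finite U" and X: "finite X" "real (card X) \<le> n" and M: "0 \<le> M"
    and T: "\<And>e. e \<in> U \<Longrightarrow> \<bar>T e\<bar> \<le> M"
    and TQ: "\<And>e. e \<in> U \<Longrightarrow> e \<notin> X \<Longrightarrow> \<bar>T e\<bar> \<le> Q e"
    and Q: "\<And>e. 0 \<le> Q e"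
  shows "\<bar>sum T U\<bar> \<le> n * M + sum Q U"
proof -
  have "\<bar>sum T U\<bar> \<le> (\<Sum>e\<in>U. (if e \<in> X then M else 0) + Q e)"
    using T TQ Q M by (intro order.trans[OF sum_abs] sum_mono) (auto intro: add_increasing2)
  also have "\<dots> = real (card (U \<inter> X)) * M + sum Q U"
    using U by (simp add: sum.distrib flip: sum.inter_restrict)
  also have "\<dots> \<le> n * M + sum Q U"
    using X M card_mono[of X "U \<inter> X"] by (intro add_right_mono mult_right_mono) auto
  finally show ?thesis .
qed

section \<open>Continuity\<close>

text \<open>\<open>\<phi>\<close> itself serves as the weight function on the pieces.\<close>

locale continuous_setting = free_group_decomposition \<P> \<Delta> R
  for \<P> :: "'a free_group set" and \<Delta> R +
  fixes \<phi> \<psi> :: "'a free_group \<Rightarrow> real" and B W :: real and s :: "nat \<Rightarrow> real"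
  assumes \<phi>_bound: "p \<in> \<P> \<Longrightarrow> \<bar>\<phi> p\<bar> \<le> B"
    and B_nonneg: "0 \<le> B"
    and \<phi>_inverse: "\<phi> (inverse g) = - \<phi> g"
    and \<phi>_sum: "\<phi> g = sum_list (map \<phi> (\<Delta> g))"
    and \<psi>_bound: "\<bar>\<delta>1 \<psi> g h\<bar> \<le> W"
    and \<psi>_inverse: "\<psi> (inverse g) = - \<psi> g"
    and s_nonneg: "0 \<le> s j"
    and s_summable: "summable s"
    and \<psi>_continuous: "(g, h) \<noteq> (g', h') \<Longrightarrow>
          \<bar>\<delta>1 \<psi> g h - \<delta>1 \<psi> g' h'\<bar> \<le> s (the_enat (triangle_agreement \<Delta> (g, h) (g', h')))"
begin

text \<open>The cocycle \<open>\<delta>1 \<psi>\<close> in homogeneous coordinates. It is alternating because \<open>\<psi>\<close> is symmetric.\<close>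

definition tri :: "'a free_group \<Rightarrow> 'a free_group \<Rightarrow> 'a free_group \<Rightarrow> real" where
  "tri x y z = \<psi> (inverse x * y) + \<psi> (inverse y * z) + \<psi> (inverse z * x)"

lemma \<psi>_swap: "\<psi> (inverse x * y) = - \<psi> (inverse y * x)"
  using \<psi>_inverse[of "inverse y * x"] by (simp add: inverse_mult)

lemma tri_swap: "tri x y z = - tri y x z"
  using \<psi>_swap[of x y] \<psi>_swap[of y z] \<psi>_swap[of z x] by (simp add: tri_def)

lemma \<delta>1_eq_tri: "\<delta>1 \<psi> g h = tri x (x * g) (x * g * h)"
  using \<psi>_inverse[of "g * h"]
  by (simp add: \<delta>1_def tri_def inverse_mult mult.assoc)

lemma tri_cocycle: "tri y z w - tri x z w + tri x y w - tri x y z = 0"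
  using \<psi>_swap[of x z] \<psi>_swap[of y w] \<psi>_swap[of x w] \<psi>_swap[of x y] \<psi>_swap[of z w] \<psi>_swap[of y z]
  by (simp add: tri_def)

lemma tri_bound: "\<bar>tri x y z\<bar> \<le> W"
  using \<psi>_bound[of "inverse x * y" "inverse y * z"]
  by (simp add: \<delta>1_eq_tri[of _ _ x])

text \<open>The contribution of an edge, seen from the point \<open>v\<close>; it does not depend on the orientation
  of the edge.\<close>

definition edge_value :: "'a free_group \<times> 'a free_group \<Rightarrow> 'a free_group \<Rightarrow> real" where
  "edge_value e v = \<phi> (inverse (fst e) * snd e) * tri (snd e) (fst e) v"

lemma \<phi>_swap: "\<phi> (inverse x * y) = - \<phi> (inverse y * x)"
  using \<phi>_inverse[of "inverse y * x"] by (simp add: inverse_mult)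

lemma edge_value_swap [simp]: "edge_value (prod.swap e) v = edge_value e v"
  using \<phi>_swap[of "fst e" "snd e"] tri_swap[of "fst e" "snd e" v] by (simp add: edge_value_def)

text \<open>Bound for the contribution of one edge.\<close>

definition M :: real where "M = B * W"

lemma W_nonneg: "0 \<le> W"
  using \<psi>_bound[of 1 1] by linarith

lemma M_nonneg: "0 \<le> M"
  by (simp add: M_def B_nonneg W_nonneg)

lemma piece_tri_bound: "inverse p * q \<in> \<P> \<Longrightarrow> \<bar>\<phi> (inverse p * q) * tri x y z\<bar> \<le> M"
  unfolding M_def abs_mult using \<phi>_bound tri_bound B_nonneg W_nonneg
  by (intro mult_mono) auto

lemma edge_value_bound: "e \<in> edges x y \<Longrightarrow> \<bar>edge_value e v\<bar> \<le> M"
  unfolding edge_value_def by (intro piece_tri_bound) (auto intro: edges_piece simp: case_prod_beta)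

section \<open>Triangles that extend a path by one piece, and continuity along a path\<close>

lemma c_part_Cons:
  assumes "\<Delta> (p * a) = p # \<Delta> a"
  shows "c_part \<Delta> p a = [[inverse p], [], \<Delta> a]"
    and "r_part \<Delta> p a = [[], [], []]"
proof -
  have p: "\<Delta> p = [p]"
    using \<Delta>_prefix[of "p * a" "[p]" "\<Delta> a"] assms by simp
  have ip: "\<Delta> (inverse p) = [inverse p]"
    using p \<Delta>_inverse[of p] by (simp add: inv_seq_def)
  have "common_seq (\<Delta> p) (\<Delta> (p * a)) = [p]"
    using common_seq_append[of "[]" "\<Delta> a" "[p]"] by (simp add: p assms diverging_def)
  moreover have "common_seq (\<Delta> (inverse p)) (\<Delta> a) = []"
  proof -
    have "diverging [inverse p] (\<Delta> a)"
    proof (cases "\<Delta> a")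
      case (Cons q qs)
      \<comment> \<open>Otherwise \<open>[p, inverse p]\<close> would be a prefix of a decomposition
        and hence equal to \<open>\<Delta> 1\<close>, which is empty.\<close>
      have "q \<noteq> inverse p"
        using \<Delta>_prefix[of "p * a" "[p, q]" qs] assms Cons by auto
      then show ?thesis by (simp add: diverging_def Cons)
    qed (simp add: diverging_def)
    then show ?thesis
      using common_seq_append[of "[inverse p]" "\<Delta> a" "[]"] by (simp add: ip)
  qed
  moreover have ia: "\<Delta> (inverse a * inverse p) = \<Delta> (inverse a) @ [inverse p]"
    using \<Delta>_inverse[of "p * a"] \<Delta>_inverse[of a]
    by (simp add: assms inverse_mult inv_seq_def)
  moreover have "common_seq (\<Delta> (inverse a)) (\<Delta> (inverse a * inverse p)) = \<Delta> (inverse a)"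
    using common_seq_append[of "[]" "[inverse p]" "\<Delta> (inverse a)"] by (simp add: ia diverging_def)
  ultimately show c: "c_part \<Delta> p a = [[inverse p], [], \<Delta> a]"
    by (simp add: c_part_def \<Delta>_inverse) (simp add: inv_seq_def)
  have "is_r_part \<Delta> p a rs \<longleftrightarrow> rs = [[], [], []]" for rs
    unfolding is_r_part_def c by (auto simp: p ia \<Delta>_inverse) (auto simp: inv_seq_def)
  then show "r_part \<Delta> p a = [[], [], []]"
    by (simp add: r_part_def)
qed

text \<open>For fixed \<open>p\<close> the \<open>r\<close>-parts are empty and only the third
  \<open>c\<close>-sequence varies, being \<open>\<Delta> a\<close> or \<open>\<Delta> b\<close>.
  The agreement is thus the length of their longest common prefix.\<close>

lemma triangle_agreement_Cons:
  assumes p: "\<Delta> (p * a) = p # \<Delta> a" "\<Delta> (p * b) = p # \<Delta> b"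
    and c: "\<Delta> a = c @ u" "\<Delta> b = c @ v" "diverging u v" and "a \<noteq> b"
  shows "triangle_agreement \<Delta> (p, a) (p, b) = enat (length c)"
proof -
  have ne: "\<Delta> a \<noteq> \<Delta> b" using prod_list_\<Delta> \<open>a \<noteq> b\<close> by metis
  let ?P = "\<lambda>N. N \<le> min (length (\<Delta> a)) (length (\<Delta> b)) \<and> (\<forall>k<N. \<Delta> a ! k = \<Delta> b ! k)"
  have "(GREATEST N. ?P N) = length c"
  proof (rule Greatest_equality)
    show "?P (length c)" by (simp add: c nth_append)
  next
    fix N
    assume N: "?P N"
    show "N \<le> length c"
    proof (rule ccontr)
      assume "\<not> N \<le> length c"
      then have "\<Delta> a ! length c = \<Delta> b ! length c" "u \<noteq> []" "v \<noteq> []"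
        using N by (auto simp: c)
      then show False using c(3) by (simp add: c(1,2) diverging_def hd_conv_nth nth_append)
    qed
  qed
  moreover have "(\<forall>j<3. [[inverse p], [], \<Delta> a] ! j \<noteq> [[inverse p], [], \<Delta> b] ! j \<longrightarrow>
     N \<le> min (length ([[inverse p], [], \<Delta> a] ! j)) (length ([[inverse p], [], \<Delta> b] ! j)) \<and>
       (\<forall>k<N. [[inverse p], [], \<Delta> a] ! j ! k = [[inverse p], [], \<Delta> b] ! j ! k)) \<longleftrightarrow> ?P N" for N
    using ne by (simp add: All_less_Suc numeral_3_eq_3)
  ultimately show ?thesis
    using \<open>a \<noteq> b\<close> by (simp add: triangle_agreement_def c_part_Cons[OF p(1)] c_part_Cons[OF p(2)])
qed

text \<open>Beyond an edge of the common segment, the paths to \<open>x\<close> and \<open>z\<close>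
  still share its remaining \<open>n\<close> pieces, so by continuity this edge contributes at most
  \<open>B * s n\<close>. Each \<open>n < length c\<close> occurs exactly once.\<close>

lemma edge_path_variation:
  assumes "\<Delta> (inverse y * x) = c @ a" "\<Delta> (inverse y * z) = c @ b" "diverging a b"
  shows "(\<Sum>e\<leftarrow>edge_path y c. \<bar>edge_value e x - edge_value e z\<bar>) \<le> B * (\<Sum>j<length c. s j)"
  using assms
proof (induction c arbitrary: y)
  case (Cons p c)
  have tail: "\<Delta> (inverse (y * p) * x) = c @ a" if "\<Delta> (inverse y * x) = p # c @ a" for x a
  proof -
    have "inverse y * x = p * prod_list (c @ a)"
      using that by (metis prod_list_\<Delta> prod_list.Cons)
    then have "inverse (y * p) * x = prod_list (c @ a)"
      by (simp add: inverse_mult mult.assoc)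
    then show ?thesis
      using \<Delta>_suffix[of "inverse y * x" "[p]" "c @ a"] that by simp
  qed
  have x: "\<Delta> (inverse (y * p) * x) = c @ a" and z: "\<Delta> (inverse (y * p) * z) = c @ b"
    using Cons.prems tail by auto
  have p: "p \<in> \<P>" using pieces[of "inverse y * x"] Cons.prems by simp
  let ?a = "inverse (y * p) * x" and ?b = "inverse (y * p) * z"
  have pa: "p * ?a = inverse y * x" "p * ?b = inverse y * z"
    by (simp_all add: inverse_mult mult.assoc)
  have "\<bar>\<delta>1 \<psi> p ?a - \<delta>1 \<psi> p ?b\<bar> \<le> s (length c)"
  proof (cases "?a = ?b")
    \<comment> \<open>Continuity compares distinct pairs only; here the difference is 0.\<close>
    case True
    then show ?thesis by (simp add: s_nonneg)
  next
    case False
    have "triangle_agreement \<Delta> (p, ?a) (p, ?b) = enat (length c)"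
      using Cons.prems x z False by (intro triangle_agreement_Cons[OF _ _ x z]) (simp_all only: pa append_Cons not_False_eq_True)
    then show ?thesis using \<psi>_continuous[of p ?a p ?b] False by simp
  qed
  moreover have "edge_value (y, y * p) x = - (\<phi> p * \<delta>1 \<psi> p ?a)" "edge_value (y, y * p) z = - (\<phi> p * \<delta>1 \<psi> p ?b)"
    using tri_swap[of y "y * p"] by (simp_all add: edge_value_def \<delta>1_eq_tri[of _ _ y] inverse_mult mult.assoc)
  moreover have "\<bar>\<phi> p\<bar> \<le> B" using \<phi>_bound p by blast
  ultimately have "\<bar>edge_value (y, y * p) x - edge_value (y, y * p) z\<bar> \<le> B * s (length c)"
    using mult_mono[of "\<bar>\<phi> p\<bar>" B "\<bar>\<delta>1 \<psi> p ?a - \<delta>1 \<psi> p ?b\<bar>" "s (length c)"] B_nonneg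
    by (simp add: abs_mult flip: right_diff_distrib) (simp add: abs_mult abs_minus_commute flip: right_diff_distrib abs_mult)
  then show ?case
    using Cons.IH[OF x z Cons.prems(3)] by (simp add: distrib_left)
qed simp

text \<open>How much \<open>edge_value e\<close> differs at two points on the same side of the edge \<open>e\<close>.\<close>

definition osc ::
    "'a free_group \<Rightarrow> 'a free_group \<Rightarrow> 'a free_group \<Rightarrow> 'a free_group \<times> 'a free_group \<Rightarrow> real" where
  "osc y x z e = (if e \<in> edges x y \<inter> edges y z then \<bar>edge_value e x - edge_value e z\<bar> else 0)"

lemma osc_nonneg: "0 \<le> osc y x z e"
  by (simp add: osc_def)

text \<open>Bound for the total oscillation at a vertex: at most \<open>6 * R\<close> exceptional
  edges at \<open>2 * M\<close> each, and the variation along the leg, doubled because both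
  orientations count.\<close>

definition K :: real where "K = 12 * R * M + 2 * B * suminf s"

text \<open>A path meets each of its edges once and in one direction only, whereas the edge sets
  contain both orientations.\<close>

lemma sum_edges:
  fixes F :: "'a free_group \<times> 'a free_group \<Rightarrow> real"
  assumes "\<And>e. F (prod.swap e) = F e"
  shows "sum F (edges x y) = 2 * (\<Sum>e\<leftarrow>path x y. F e)"
    and "sum F (leg_edges x y z) = 2 * (\<Sum>e\<leftarrow>leg x y z. F e)"
proof -
  have *: "sum F (set es \<union> prod.swap ` set es) = 2 * (\<Sum>e\<leftarrow>es. F e)"
    if "distinct es" "set es \<inter> prod.swap ` set es = {}" for es
  proof -
    have "sum F (set es \<union> prod.swap ` set es) = sum F (set es) + sum F (prod.swap ` set es)"
      using that by (intro sum.union_disjoint) auto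
    also have "sum F (prod.swap ` set es) = sum F (set es)"
      using assms by (subst sum.reindex) (auto simp: comp_def)
    finally show ?thesis
      using that by (simp add: sum.distinct_set_conv_list)
  qed
  show "sum F (edges x y) = 2 * (\<Sum>e\<leftarrow>path x y. F e)"
    unfolding edges_def by (intro * distinct_path path_swap_disjoint)
  obtain r where r: "path x y = leg x y z @ r @ reverse_path (leg y x z)"
    using path_decomp by blast
  show "sum F (leg_edges x y z) = 2 * (\<Sum>e\<leftarrow>leg x y z. F e)"
    unfolding leg_edges_def
  proof (intro *)
    show "distinct (leg x y z)" using distinct_path[of x y] by (simp add: r)
    show "set (leg x y z) \<inter> prod.swap ` set (leg x y z) = {}"
      using path_swap_disjoint[of x y] by (auto simp: r)
  qed
qed

lemma leg_variation: "(\<Sum>e\<in>leg_edges y x z. \<bar>edge_value e x - edge_value e z\<bar>) \<le> 2 * B * suminf s"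
proof -
  define c where "c = common_seq (\<Delta> (inverse y * x)) (\<Delta> (inverse y * z))"
  obtain a b where "\<Delta> (inverse y * x) = c @ a" "\<Delta> (inverse y * z) = c @ b" "diverging a b"
    unfolding c_def by (rule common_seqE)
  then have "(\<Sum>e\<leftarrow>leg y x z. \<bar>edge_value e x - edge_value e z\<bar>) \<le> B * (\<Sum>j<length c. s j)"
    unfolding leg_def c_def[symmetric] by (rule edge_path_variation)
  also have "\<dots> \<le> B * suminf s"
    by (intro mult_left_mono sum_le_suminf s_summable B_nonneg) (auto simp: s_nonneg)
  finally show ?thesis by (simp add: sum_edges(2))
qed

lemma edge_value_diff_bound: "e \<in> edges x y \<Longrightarrow> \<bar>edge_value e v - edge_value e w\<bar> \<le> 2 * M"
  using edge_value_bound[of e x y v] edge_value_bound[of e x y w] by linarith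

text \<open>Off at most \<open>6 * R\<close> edges, the support of \<open>osc y x z\<close> is the
  leg at \<open>y\<close>, where \<open>leg_variation\<close> applies.\<close>

lemma osc_sum:
  assumes "finite U"
  shows "sum (osc y x z) U \<le> K"
proof -
  obtain X where X: "finite X" "card X \<le> 6 * R"
    and legs: "\<And>e. e \<notin> X \<Longrightarrow> e \<in> leg_edges y x z \<longleftrightarrow> e \<in> edges x y \<inter> edges y z"
    using triangle_parity[of x z y] by blast
  define Q where "Q e = (if e \<in> leg_edges y x z then \<bar>edge_value e x - edge_value e z\<bar> else 0)" for e
  have "\<bar>sum (osc y x z) U\<bar> \<le> 6 * R * (2 * M) + sum Q U"
    using assms X
  proof (rule abs_sum_le_exceptional)
    show "\<bar>osc y x z e\<bar> \<le> 2 * M" for e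
      using edge_value_diff_bound[of e x y x z] M_nonneg by (simp add: osc_def)
  qed (auto simp: M_nonneg Q_def osc_def legs)
  moreover have "sum Q U \<le> (\<Sum>e\<in>leg_edges y x z. \<bar>edge_value e x - edge_value e z\<bar>)"
    unfolding Q_def using assms
    by (subst sum.inter_restrict[symmetric]) (auto intro!: sum_mono2 simp: leg_edges_def)
  ultimately show ?thesis using leg_variation[of x z y] by (simp add: K_def)
qed

lemma sum_restrict_superset:
  fixes F :: "'b \<Rightarrow> real"
  assumes "finite U" "A \<subseteq> U"
  shows "sum F A = (\<Sum>e\<in>U. if e \<in> A then F e else 0)"
  using assms by (simp add: Int_absorb1 flip: sum.inter_restrict)

section \<open>Comparison of the sums along the legs\<close>

text \<open>Here \<open>m\<close> is the centre of a tripod. By parity and the empty legs, a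
  non-exceptional edge lies on at most one of the segments from \<open>m\<close> to
  \<open>x\<close>, \<open>y\<close>, \<open>z\<close>, so \<open>edges m y\<close> agrees with
  \<open>edges x y \<inter> edges y z\<close> off the exceptional set. There \<open>m\<close> and
  \<open>z\<close> are on the same side of the edge, and exchanging them costs
  \<open>osc y m z\<close>.\<close>

lemma center_approx:
  assumes "leg m x y = []" "leg m y z = []" "leg m x z = []"
  shows "\<bar>(\<Sum>e\<in>edges m y. edge_value e y - edge_value e m) - (\<Sum>e\<in>edges x y \<inter> edges y z. edge_value e y - edge_value e z)\<bar>
    \<le> 72 * R * M + K"
proof -
  obtain X where X: "finite X" "card X \<le> 6 * R"
    "\<And>e. e \<notin> X \<Longrightarrow> (e \<in> edges x y \<longleftrightarrow> (e \<in> edges x m) \<noteq> (e \<in> edges m y)) \<and>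
       (e \<in> leg_edges m x y \<longleftrightarrow> e \<in> edges x m \<inter> edges m y)"
    using triangle_parity[of x y m] by blast
  obtain Y where Y: "finite Y" "card Y \<le> 6 * R"
    "\<And>e. e \<notin> Y \<Longrightarrow> (e \<in> edges y z \<longleftrightarrow> (e \<in> edges y m) \<noteq> (e \<in> edges m z)) \<and>
       (e \<in> leg_edges m y z \<longleftrightarrow> e \<in> edges y m \<inter> edges m z)"
    using triangle_parity[of y z m] by blast
  obtain Z where Z: "finite Z" "card Z \<le> 6 * R"
    "\<And>e. e \<notin> Z \<Longrightarrow> (e \<in> edges x z \<longleftrightarrow> (e \<in> edges x m) \<noteq> (e \<in> edges m z)) \<and>
       (e \<in> leg_edges m x z \<longleftrightarrow> e \<in> edges x m \<inter> edges m z)"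
    using triangle_parity[of x z m] by blast
  have legs: "leg_edges m x y = {}" "leg_edges m y z = {}" "leg_edges m x z = {}"
    using assms by (simp_all add: leg_edges_def)
  let ?V = "edges x y \<inter> edges y z"
  let ?U = "edges m y \<union> ?V"
  let ?T = "\<lambda>e. (if e \<in> edges m y then edge_value e y - edge_value e m else 0) -
    (if e \<in> ?V then edge_value e y - edge_value e z else 0)"
  have "card (X \<union> Y \<union> Z) \<le> card X + card Y + card Z"
    using card_Un_le[of "X \<union> Y" Z] card_Un_le[of X Y] by linarith
  then have "real (card (X \<union> Y \<union> Z)) \<le> 18 * R"
    using X(2) Y(2) Z(2) by linarith
  with _ _ have "\<bar>sum ?T ?U\<bar> \<le> 18 * R * (4 * M) + sum (osc y m z) ?U"
  proof (rule abs_sum_le_exceptional)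
    show "\<bar>?T e\<bar> \<le> 4 * M" for e
      using edge_value_diff_bound[of e m y y m] edge_value_diff_bound[of e x y y z] M_nonneg by auto
    fix e
    assume "e \<notin> X \<union> Y \<union> Z"
    then have "e \<in> edges x y \<longleftrightarrow> (e \<in> edges x m) \<noteq> (e \<in> edges m y)"
      "e \<in> edges y z \<longleftrightarrow> (e \<in> edges m y) \<noteq> (e \<in> edges m z)"
      "\<not> (e \<in> edges x m \<and> e \<in> edges m y)" "\<not> (e \<in> edges m y \<and> e \<in> edges m z)"
      "\<not> (e \<in> edges x m \<and> e \<in> edges m z)"
      using X(3)[of e] Y(3)[of e] Z(3)[of e]
      unfolding legs edges_commute[of y m] by blast+
    then have "e \<in> edges m y \<longleftrightarrow> e \<in> ?V" by blast
    then show "\<bar>?T e\<bar> \<le> osc y m z e"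
      by (auto simp: osc_def abs_minus_commute)
  qed (use X Y Z in \<open>auto simp: M_nonneg osc_nonneg\<close>)
  moreover have "sum ?T ?U = (\<Sum>e\<in>edges m y. edge_value e y - edge_value e m) - (\<Sum>e\<in>?V. edge_value e y - edge_value e z)"
  proof -
    have "finite ?U" "edges m y \<subseteq> ?U" "?V \<subseteq> ?U" by auto
    note * = this(2,3)[THEN sum_restrict_superset[OF this(1)]]
    show ?thesis unfolding * sum_subtractf[symmetric] ..
  qed
  ultimately show ?thesis using osc_sum[of ?U y m z] by simp
qed

lemma sum_list_bound:
  fixes F :: "'b \<Rightarrow> real" and C :: real
  assumes "\<And>e. e \<in> set es \<Longrightarrow> \<bar>F e\<bar> \<le> C"
  shows "\<bar>\<Sum>e\<leftarrow>es. F e\<bar> \<le> length es * C"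
  using assms
proof (induction es)
  case (Cons e es)
  then have "\<bar>F e\<bar> \<le> C" "\<bar>\<Sum>e\<leftarrow>es. F e\<bar> \<le> length es * C" by simp_all
  then show ?case by (simp add: distrib_right)
qed simp

text \<open>The legs at \<open>x\<close> and \<open>z\<close> are traversed in the same direction by
  two sides with opposite signs and cancel. The leg at \<open>y\<close> is traversed once in each
  direction, which leaves differences of edge values.\<close>

lemma boundary_approx:
  fixes x y z w :: "'a free_group"
  defines "H \<equiv> \<lambda>e. \<phi> (inverse (fst e) * snd e) * tri (snd e) z w"
  shows "\<bar>2 * ((\<Sum>e\<leftarrow>path x y. H e) + (\<Sum>e\<leftarrow>path y z. H e) - (\<Sum>e\<leftarrow>path x z. H e)) -
    (\<Sum>e\<in>edges x y \<inter> edges y z. edge_value e w - edge_value e z)\<bar> \<le> 18 * R * M"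
proof -
  have rev: "(\<Sum>e\<leftarrow>reverse_path es. H e) = (\<Sum>e\<leftarrow>es. H (prod.swap e))" for es
    by (simp add: reverse_path_def rev_map[symmetric] comp_def)
  have cancel: "H e + H (prod.swap e) = edge_value e w - edge_value e z" for e
  proof -
    \<comment> \<open>The term \<open>tri (fst e) z w\<close> drops out of the sum over both
      orientations, since \<open>\<phi>\<close> changes sign.\<close>
    have *: "tri (snd e) z w = tri (fst e) z w + tri (snd e) (fst e) w - tri (snd e) (fst e) z"
      using tri_cocycle[of "fst e" z w "snd e"] by linarith
    show ?thesis
      unfolding H_def edge_value_def * using \<phi>_swap[of "fst e" "snd e"] by (simp add: algebra_simps)
  qed
  have H_bound: "\<bar>\<Sum>e\<leftarrow>r. H e\<bar> \<le> R * M"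
    if "path u v = us @ r @ vs" "length r \<le> R" for u v us r vs
  proof -
    have "\<bar>\<Sum>e\<leftarrow>r. H e\<bar> \<le> length r * M"
      unfolding H_def
      by (rule sum_list_bound, rule piece_tri_bound, rule path_piece[of _ _ u v])
         (use that(1) in auto)
    also have "\<dots> \<le> R * M" using that(2) M_nonneg by (rule mult_right_mono)
    finally show ?thesis .
  qed
  obtain r1 where r1: "path x y = leg x y z @ r1 @ reverse_path (leg y x z)" "length r1 \<le> R"
    using path_decomp by blast
  obtain r2 where r2: "path y z = leg y x z @ r2 @ reverse_path (leg z x y)" "length r2 \<le> R"
    using path_decomp[of y z x] by (metis leg_commute)
  obtain r3 where r3: "path x z = leg x y z @ r3 @ reverse_path (leg z x y)" "length r3 \<le> R"
    using path_decomp[of x z y] by (metis leg_commute)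
  let ?L = "leg_edges y x z" and ?V = "edges x y \<inter> edges y z"
  let ?S = "(\<Sum>e\<leftarrow>path x y. H e) + (\<Sum>e\<leftarrow>path y z. H e) - (\<Sum>e\<leftarrow>path x z. H e)"
  have "?S = (\<Sum>e\<leftarrow>leg y x z. edge_value e w - edge_value e z) +
      ((\<Sum>e\<leftarrow>r1. H e) + (\<Sum>e\<leftarrow>r2. H e) - (\<Sum>e\<leftarrow>r3. H e))"
    unfolding r1(1) r2(1) r3(1) cancel[symmetric] by (simp add: rev sum_list_addf)
  then have 1: "\<bar>?S - (\<Sum>e\<leftarrow>leg y x z. edge_value e w - edge_value e z)\<bar> \<le> 3 * (R * M)"
    using H_bound[OF r1] H_bound[OF r2] H_bound[OF r3] by linarith
  obtain X where X: "finite X" "card X \<le> 6 * R"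
    "\<And>e. e \<notin> X \<Longrightarrow> e \<in> ?L \<longleftrightarrow> e \<in> ?V"
    using triangle_parity[of x z y] by blast
  have L: "?L \<subseteq> edges x y"
    by (auto simp: leg_edges_def edges_def r1(1))
  let ?T = "\<lambda>e. (if e \<in> ?L then edge_value e w - edge_value e z else 0) - (if e \<in> ?V then edge_value e w - edge_value e z else 0)"
  have "\<bar>sum ?T (edges x y)\<bar> \<le> 6 * R * (2 * M) + (\<Sum>e\<in>edges x y. 0)"
    using finite_edges X(1,2)
  proof (rule abs_sum_le_exceptional)
    show "\<bar>?T e\<bar> \<le> 2 * M" if "e \<in> edges x y" for e
      using edge_value_diff_bound[OF that, of w z] M_nonneg by auto
  qed (use X(3) in \<open>auto simp: M_nonneg\<close>)
  moreover have "sum ?T (edges x y) = (\<Sum>e\<in>?L. edge_value e w - edge_value e z) - (\<Sum>e\<in>?V. edge_value e w - edge_value e z)"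
  proof -
    have "?V \<subseteq> edges x y" by auto
    note * = L[THEN sum_restrict_superset[OF finite_edges]] this[THEN sum_restrict_superset[OF finite_edges]]
    show ?thesis unfolding * sum_subtractf[symmetric] ..
  qed
  moreover have "(\<Sum>e\<in>?L. edge_value e w - edge_value e z) = 2 * (\<Sum>e\<leftarrow>leg y x z. edge_value e w - edge_value e z)"
    by (rule sum_edges) simp
  \<comment> \<open>After doubling, \<open>r1\<close>, \<open>r2\<close>, \<open>r3\<close> cost
    \<open>6 * R * M\<close>; replacing the leg by \<open>edges x y \<inter> edges y z\<close> costs
    \<open>12 * R * M\<close>.\<close>
  ultimately show ?thesis using 1 by (auto simp: abs_le_iff)
qed

end

text \<open>For an edge \<open>e\<close> of a tetrahedron \<open>x y z w\<close>, \<open>a, b, c\<close> stand for \<open>edge_value e\<close> at \<open>y, z, w\<close>.\<close>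

lemma tetrahedron_cancellation:
  fixes a b c :: real
  assumes "xz \<longleftrightarrow> xy \<noteq> yz" "xw \<longleftrightarrow> xy \<noteq> yw" "yw \<longleftrightarrow> yz \<noteq> zw" "xw \<longleftrightarrow> xz \<noteq> zw"
  shows "\<bar>2 * (if xy \<and> yz then c - b else 0) + (if yz \<and> zw then b - c else 0) -
      (if xz \<and> zw then b - c else 0) + (if xy \<and> yw then a - c else 0) -
      (if xy \<and> yz then a - b else 0)\<bar> \<le>
    (if yz \<and> yw then \<bar>b - c\<bar> else 0) + (if xy \<and> xw then \<bar>a - c\<bar> else 0) +
      (if xy \<and> xz then \<bar>a - b\<bar> else 0)"
  using assms by (cases xy; cases yz; cases zw) auto

context continuous_setting
begin

text \<open>These are the main terms of \<open>4 \<beta>\<close>: the first sum comes from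
  \<open>boundary_approx\<close>, the others from \<open>gamma_approx\<close> on the four faces. A
  non-exceptional edge leaves one oscillation at \<open>y\<close> and two at \<open>x\<close>; each
  of the four faces has at most \<open>6 * R\<close> exceptional edges, at \<open>12 * M\<close>
  each.\<close>

lemma tetrahedron_bound:
  fixes x y z w :: "'a free_group"
  shows "\<bar>2 * (\<Sum>e\<in>edges x y \<inter> edges y z. edge_value e w - edge_value e z) +
      (\<Sum>e\<in>edges y z \<inter> edges z w. edge_value e z - edge_value e w) -
      (\<Sum>e\<in>edges x z \<inter> edges z w. edge_value e z - edge_value e w) +
      (\<Sum>e\<in>edges x y \<inter> edges y w. edge_value e y - edge_value e w) -
      (\<Sum>e\<in>edges x y \<inter> edges y z. edge_value e y - edge_value e z)\<bar> \<le> 288 * R * M + 3 * K"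
proof -
  \<comment> \<open>The exceptional set is chosen as a function of the triangle, to be used on all
    four faces.\<close>
  define P where "P x y z X \<longleftrightarrow> finite X \<and> real (card X) \<le> 6 * R \<and>
     (\<forall>e. e \<notin> X \<longrightarrow> (e \<in> edges x z \<longleftrightarrow> (e \<in> edges x y) \<noteq> (e \<in> edges y z)))" for x y z X
  have ex: "\<exists>X. P x y z X" for x y z
    unfolding P_def using triangle_parity[of x z y] by blast
  define X where "X x y z = (SOME X. P x y z X)" for x y z
  have "P x y z (X x y z)" for x y z
    unfolding X_def by (rule someI_ex[OF ex])
  then have X: "\<And>x y z. finite (X x y z)" "\<And>x y z. real (card (X x y z)) \<le> 6 * R"
    "\<And>x y z e. e \<notin> X x y z \<Longrightarrow> e \<in> edges x z \<longleftrightarrow> (e \<in> edges x y) \<noteq> (e \<in> edges y z)"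
    unfolding P_def by blast+
  let ?X = "X x y z \<union> X x y w \<union> (X y z w \<union> X x z w)"
  let ?U = "edges x y \<union> edges y z \<union> edges z w"
  let ?T = "\<lambda>e. 2 * (if e \<in> edges x y \<inter> edges y z then edge_value e w - edge_value e z else 0) +
      (if e \<in> edges y z \<inter> edges z w then edge_value e z - edge_value e w else 0) -
      (if e \<in> edges x z \<inter> edges z w then edge_value e z - edge_value e w else 0) +
      (if e \<in> edges x y \<inter> edges y w then edge_value e y - edge_value e w else 0) -
      (if e \<in> edges x y \<inter> edges y z then edge_value e y - edge_value e z else 0)"
  have "card ?X \<le> card (X x y z) + card (X x y w) + (card (X y z w) + card (X x z w))"
    by (intro order.trans[OF card_Un_le] add_mono) simp_all
  then have "real (card ?X) \<le> 24 * R"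
    using X(2)[of x y z] X(2)[of x y w] X(2)[of y z w] X(2)[of x z w] by linarith
  with _ _ have "\<bar>sum ?T ?U\<bar> \<le> 24 * R * (12 * M) +
    (\<Sum>e\<in>?U. osc y z w e + osc x y w e + osc x y z e)"
  proof (rule abs_sum_le_exceptional)
    fix e
    assume "e \<in> ?U"
    then have "\<bar>edge_value e v - edge_value e v'\<bar> \<le> 2 * M" for v v' by (auto intro: edge_value_diff_bound)
    from this[of w z] this[of z w] this[of y w] this[of y z] show "\<bar>?T e\<bar> \<le> 12 * M"
      using M_nonneg by (auto split: if_splits)
    assume "e \<notin> ?X"
    then have "e \<in> edges x z \<longleftrightarrow> (e \<in> edges x y) \<noteq> (e \<in> edges y z)"
      "e \<in> edges x w \<longleftrightarrow> (e \<in> edges x y) \<noteq> (e \<in> edges y w)"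
      "e \<in> edges y w \<longleftrightarrow> (e \<in> edges y z) \<noteq> (e \<in> edges z w)"
      "e \<in> edges x w \<longleftrightarrow> (e \<in> edges x z) \<noteq> (e \<in> edges z w)"
      using X(3) by blast+
    from tetrahedron_cancellation[OF this, of "edge_value e w" "edge_value e z" "edge_value e y"]
    show "\<bar>?T e\<bar> \<le> osc y z w e + osc x y w e + osc x y z e"
      by (simp add: osc_def edges_commute[of z y] edges_commute[of y x] Int_iff)
  qed (auto simp: X(1) M_nonneg osc_nonneg)
  also have "(\<Sum>e\<in>?U. osc y z w e + osc x y w e + osc x y z e) \<le> 3 * K"
    using osc_sum[of ?U y z w] osc_sum[of ?U x y w] osc_sum[of ?U x y z]
    by (simp add: sum.distrib)
  also have "sum ?T ?U = 2 * (\<Sum>e\<in>edges x y \<inter> edges y z. edge_value e w - edge_value e z) +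
      (\<Sum>e\<in>edges y z \<inter> edges z w. edge_value e z - edge_value e w) -
      (\<Sum>e\<in>edges x z \<inter> edges z w. edge_value e z - edge_value e w) +
      (\<Sum>e\<in>edges x y \<inter> edges y w. edge_value e y - edge_value e w) -
      (\<Sum>e\<in>edges x y \<inter> edges y z. edge_value e y - edge_value e z)"
  proof -
    have "finite ?U" "edges x y \<inter> edges y z \<subseteq> ?U" "edges y z \<inter> edges z w \<subseteq> ?U"
      "edges x z \<inter> edges z w \<subseteq> ?U" "edges x y \<inter> edges y w \<subseteq> ?U" by auto
    note * = this(2-5)[THEN sum_restrict_superset[OF this(1)]]
    show ?thesis unfolding * unfolding sum.distrib sum_subtractf sum_distrib_left ..
  qed
  finally show ?thesis by simp
qed

section \<open>The cochains in homogeneous coordinates\<close>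

text \<open>The product behind the \<open>j\<close>-th piece starts at the end of the
  \<open>j\<close>-th edge, hence \<open>snd e\<close> and not \<open>fst e\<close>. The base point
  \<open>x\<close> is free by left invariance.\<close>

lemma sum_pieces_eq:
  "(\<Sum>j<length gs. \<phi> (gs ! j) * \<delta>1 \<psi> (prod_list (drop (Suc j) gs) * h) i) =
   (\<Sum>e\<leftarrow>edge_path x gs. \<phi> (inverse (fst e) * snd e) *
      tri (snd e) (x * prod_list gs * h) (x * prod_list gs * h * i))"
proof (induction gs arbitrary: x)
  case (Cons g gs)
  have "\<delta>1 \<psi> (prod_list gs * h) i =
      tri (x * g) (x * g * prod_list gs * h) (x * g * prod_list gs * h * i)"
    using \<delta>1_eq_tri[of "prod_list gs * h" i "x * g"] by (simp add: mult.assoc)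
  then show ?case
    using Cons[of "x * g"] by (simp add: sum.lessThan_Suc_shift mult.assoc del: sum.lessThan_Suc)
qed simp

definition zeta ::
    "'a free_group \<Rightarrow> 'a free_group \<Rightarrow> 'a free_group \<Rightarrow> real" where
  "zeta g h i =
    (\<Sum>j<length (\<Delta> g). \<phi> (\<Delta> g ! j) * \<delta>1 \<psi> (prod_list (drop (Suc j) (\<Delta> g)) * h) i)"

definition eta :: "'a free_group \<Rightarrow> 'a free_group \<Rightarrow> real" where
  "eta g h = zeta g 1 h"

definition gamma :: "'a free_group \<Rightarrow> 'a free_group \<Rightarrow> real" where
  "gamma g h = (let d = common_2path g h in 1 / 2 * (zeta d (inverse d) d + zeta (inverse d) 1 d))"

lemma zeta_eq:
  "zeta (inverse x * y) (inverse y * z) (inverse z * w) =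
    (\<Sum>e\<leftarrow>path x y. \<phi> (inverse (fst e) * snd e) * tri (snd e) z w)"
  by (simp add: zeta_def path_def sum_pieces_eq[of "\<Delta> (inverse x * y)" _ _ x])

lemma eta_eq:
  "eta (inverse x * y) (inverse y * z) =
    (\<Sum>e\<leftarrow>path x y. \<phi> (inverse (fst e) * snd e) * tri (snd e) y z)"
  using zeta_eq[of x y y z] by (simp add: eta_def)

text \<open>\<open>\<phi> g\<close> splits over the pieces, and for each tail \<open>a\<close> of
  \<open>\<Delta> g\<close> the cocycle identity merges three values of
  \<open>\<delta>1 \<psi>\<close> into one.\<close>

lemma zeta_eta:
  "\<phi> g * \<delta>1 \<psi> h i + \<delta>2 eta g h i = zeta g h i + eta h i - eta (g * h) i"
proof -
  have "\<phi> g * \<delta>1 \<psi> h i = (\<Sum>j<length (\<Delta> g). \<phi> (\<Delta> g ! j)) * \<delta>1 \<psi> h i"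
    using \<phi>_sum[of g] by (simp add: sum_list_sum_nth atLeast0LessThan)
  moreover have "\<delta>1 \<psi> h i + \<delta>1 \<psi> a (h * i) - \<delta>1 \<psi> a h = \<delta>1 \<psi> (a * h) i" for a
    by (simp add: \<delta>1_def mult.assoc)
  then have "\<phi> p * \<delta>1 \<psi> h i + (\<phi> p * \<delta>1 \<psi> a (h * i) - \<phi> p * \<delta>1 \<psi> a h) = \<phi> p * \<delta>1 \<psi> (a * h) i" for a p
    by (metis (no_types) distrib_left right_diff_distrib add_diff_eq)
  ultimately show ?thesis
    by (simp add: \<delta>2_def eta_def zeta_def sum_distrib_right flip: sum.distrib sum_subtractf)
qed

text \<open>The two summands of \<open>gamma\<close> run along the segment between the centre
  \<open>m\<close> and \<open>y\<close> in opposite directions, and pairing the orientations gives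
  edge values. The factor 4 absorbs the \<open>1 / 2\<close> and the double count of edges;
  \<open>center_approx\<close> then eliminates \<open>m\<close>.\<close>

lemma gamma_approx:
  "\<bar>4 * gamma (inverse x * y) (inverse y * z) - (\<Sum>e\<in>edges x y \<inter> edges y z. edge_value e y - edge_value e z)\<bar>
    \<le> 72 * R * M + K"
proof -
  define d where "d = common_2path (inverse x * y) (inverse y * z)"
  \<comment> \<open>The centre of the tripod with endpoints \<open>x\<close>, \<open>y\<close>,
    \<open>z\<close>.\<close>
  define m where "m = y * inverse d"
  obtain t1 t2 where t: "reduced_product (inverse x * y) [inverse t1, d]"
      "reduced_product (inverse y * z) [inverse d, t2]"
      "reduced_product (inverse x * y * (inverse y * z)) [inverse t1, t2]"
    using common_2path[of "inverse x * y" "inverse y * z"] unfolding d_def by blast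
  have d: "d = inverse m * y" by (simp add: m_def inverse_mult mult.assoc)
  have "x * (inverse t1 * d) = y" using t(1) by (simp add: reduced_product_def) (metis inverse_mult_cancel(2))
  then have t1: "inverse t1 = inverse x * m"
    unfolding m_def by (metis inverse_mult_cancel(1) mult.assoc free_group.right_inverse mult.right_neutral)
  have "y * (inverse d * t2) = z" using t(2) by (simp add: reduced_product_def) (metis inverse_mult_cancel(2))
  then have t2: "t2 = inverse m * z"
    unfolding m_def by (metis inverse_mult_cancel(1) mult.assoc)
  have legs: "leg m x y = []" "leg m y z = []" "leg m x z = []"
    using t unfolding t1 t2 d by (simp_all add: leg_reduced inverse_mult)
  have "zeta d (inverse d) d = (\<Sum>e\<leftarrow>path m y. \<phi> (inverse (fst e) * snd e) * tri (snd e) m y)"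
    using zeta_eq[of m y m y] by (simp add: d inverse_mult)
  moreover have "zeta (inverse d) 1 d = (\<Sum>e\<leftarrow>path y m. \<phi> (inverse (fst e) * snd e) * tri (snd e) m y)"
    using zeta_eq[of y m m y] by (simp add: d inverse_mult)
  moreover have "\<dots> = (\<Sum>e\<leftarrow>path m y. \<phi> (inverse (snd e) * fst e) * tri (fst e) m y)"
    by (simp add: path_reverse[of m y] reverse_path_def comp_def flip: rev_map)
  moreover have "\<phi> (inverse p * q) * tri q m y + \<phi> (inverse q * p) * tri p m y = edge_value (p, q) y - edge_value (p, q) m" for p q
  proof -
    have *: "tri q m y = tri p m y + tri q p y - tri q p m"
      using tri_cocycle[of p m y q] by linarith
    show ?thesis
      unfolding edge_value_def * using \<phi>_swap[of p q] by (simp add: algebra_simps)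
  qed
  ultimately have "zeta d (inverse d) d + zeta (inverse d) 1 d = (\<Sum>e\<leftarrow>path m y. edge_value e y - edge_value e m)"
    by (simp add: case_prod_beta flip: sum_list_addf)
  also have "2 * \<dots> = (\<Sum>e\<in>edges m y. edge_value e y - edge_value e m)"
    by (rule sum_edges(1)[symmetric]) simp
  finally have "4 * gamma (inverse x * y) (inverse y * z) = (\<Sum>e\<in>edges m y. edge_value e y - edge_value e m)"
    by (simp add: gamma_def Let_def flip: d_def)
  then show ?thesis using center_approx[OF legs] by simp
qed

lemma beta_bounded:
  "\<bar>\<phi> g * \<delta>1 \<psi> h i + \<delta>2 gamma g h i + \<delta>2 eta g h i\<bar> \<le> 153 * R * M + 7 / 4 * K"
proof -
  define x y z w where "x = (1 :: 'a free_group)" and "y = g" and "z = g * h" and "w = g * h * i"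
  have g: "g = inverse x * y" "h = inverse y * z" "i = inverse z * w" "g * h = inverse x * z"
    "h * i = inverse y * w"
    by (simp_all add: x_def y_def z_def w_def inverse_mult mult.assoc)
  let ?H = "\<lambda>e. \<phi> (inverse (fst e) * snd e) * tri (snd e) z w"
  have "zeta g h i + eta h i - eta (g * h) i =
      (\<Sum>e\<leftarrow>path x y. ?H e) + (\<Sum>e\<leftarrow>path y z. ?H e) - (\<Sum>e\<leftarrow>path x z. ?H e)"
    unfolding g by (simp add: zeta_eq eta_eq mult.assoc)
  then have 1: "\<bar>2 * (\<phi> g * \<delta>1 \<psi> h i + \<delta>2 eta g h i) -
      (\<Sum>e\<in>edges x y \<inter> edges y z. edge_value e w - edge_value e z)\<bar> \<le> 18 * R * M"
    using boundary_approx[where x = x and y = y and z = z and w = w] unfolding zeta_eta by (simp only:)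
  have 2: "\<delta>2 gamma g h i = gamma (inverse y * z) (inverse z * w) - gamma (inverse x * z) (inverse z * w)
      + gamma (inverse x * y) (inverse y * w) - gamma (inverse x * y) (inverse y * z)"
    by (simp only: \<delta>2_def g(4,5)) (simp only: g)
  \<comment> \<open>For \<open>4 \<beta>\<close> the errors are \<open>2 * (18 * R * M)\<close>,
    \<open>4 * (72 * R * M + K)\<close> and \<open>288 * R * M + 3 * K\<close>, in total
    \<open>612 * R * M + 7 * K\<close>.\<close>
  show ?thesis
    using 1 2 gamma_approx[of y z w] gamma_approx[of x z w] gamma_approx[of x y w]
      gamma_approx[of x y z] tetrahedron_bound[where x = x and y = y and z = z and w = w]
    by (auto simp: abs_le_iff)
qed

end

section \<open>Deduction of the theorem from the bound for fixed data\<close>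

theorem theorem3:
  fixes \<P> :: "'a free_group set"
    and \<Delta> :: "'a free_group \<Rightarrow> 'a free_group list"
    and \<phi> :: "'a free_group \<Rightarrow> real"
    and \<omega> \<eta> \<gamma> :: "'a free_group \<Rightarrow> 'a free_group \<Rightarrow> real"
    and \<zeta> \<beta> :: "'a free_group \<Rightarrow> 'a free_group \<Rightarrow> 'a free_group \<Rightarrow> real"
  assumes nonabelian: "\<exists>x y :: 'a free_group. x * y \<noteq> y * x"
    and decomposition: "decomposition \<P> \<Delta>"
    and decomposable: "decomposable \<P> \<Delta> \<phi>"
    and continuous: "delta_continuous_cocycle \<Delta> \<omega>"
    and \<zeta>: "\<And>g h i. \<zeta> g h i =
      (\<Sum>j<length (\<Delta> g). \<phi> (\<Delta> g ! j) * \<omega> (prod_list (drop (Suc j) (\<Delta> g)) * h) i)"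
    and \<eta>: "\<And>g h. \<eta> g h = \<zeta> g 1 h"
    and \<gamma>: "\<And>g h. \<gamma> g h =
      (let d = common_2path g h in 1 / 2 * (\<zeta> d (inverse d) d + \<zeta> (inverse d) 1 d))"
    and \<beta>: "\<And>g h i. \<beta> g h i = \<phi> g * \<omega> h i + \<delta>2 \<gamma> g h i + \<delta>2 \<eta> g h i"
  shows "bounded_3cochain \<beta>"
proof -
  obtain \<psi> where \<psi>: "delta_continuous \<Delta> \<psi>" and \<omega>: "\<omega> = \<delta>1 \<psi>"
    using continuous by (auto simp: delta_continuous_cocycle_def)
  obtain s where s: "\<And>j. s j \<ge> 0" "summable s" "\<And>g h g' h'. (g, h) \<noteq> (g', h') \<Longrightarrow>
      \<bar>\<delta>1 \<psi> g h - \<delta>1 \<psi> g' h'\<bar> \<le> s (the_enat (triangle_agreement \<Delta> (g, h) (g', h')))"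
    using \<psi> unfolding delta_continuous_def by blast
  obtain W where W: "\<And>g h. \<bar>\<delta>1 \<psi> g h\<bar> \<le> W"
    using \<psi> by (auto simp: delta_continuous_def quasimorphism_def)
  obtain l B where l: "\<And>p. p \<in> \<P> \<Longrightarrow> \<bar>l p\<bar> \<le> B" "\<And>p. p \<in> \<P> \<Longrightarrow> l (inverse p) = - l p"
      "\<And>g. \<phi> g = sum_list (map l (\<Delta> g))"
    using decomposable by (auto simp: decomposable_def)
  obtain R :: real where R: "\<And>g h. \<exists>rs. is_r_part \<Delta> g h rs \<and> (\<forall>r\<in>set rs. real (length r) \<le> R)"
    using decomposition unfolding decomposition_def by blast
  \<comment> \<open>A piece \<open>p\<close> occurring in no \<open>\<Delta> g\<close> may have \<open>\<Delta> p \<noteq> [p]\<close>, and \<open>\<phi>\<close> may be unbounded on such pieces.\<close>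
  define \<P>' where "\<P>' = (\<Union>g. set (\<Delta> g))"
  have \<Delta>_inverse: "\<Delta> (inverse g) = inv_seq (\<Delta> g)" and \<P>': "\<P>' \<subseteq> \<P>" for g
    using decomposition by (auto simp: decomposition_def \<P>'_def)
  have "inverse p \<in> \<P>'" if "p \<in> \<P>'" for p
  proof -
    obtain g where "p \<in> set (\<Delta> g)" using \<open>p \<in> \<P>'\<close> by (auto simp: \<P>'_def)
    then have "inverse p \<in> set (\<Delta> (inverse g))" by (simp add: \<Delta>_inverse inv_seq_def)
    then show ?thesis by (auto simp: \<P>'_def)
  qed
  moreover have "\<Delta> g \<in> lists \<P>'" for g
    by (auto simp: \<P>'_def)
  ultimately have "decomposition \<P>' \<Delta>"
    using decomposition \<P>' unfolding decomposition_def by blast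
  then interpret free_group_decomposition \<P>' \<Delta> R
    using R by unfold_locales
  \<comment> \<open>A piece that occurs in some \<open>\<Delta> g\<close> is its own decomposition,
    so its weight is its value under \<open>\<phi>\<close>.\<close>
  have \<phi>_l: "\<phi> p = l p" if "p \<in> set (\<Delta> g)" for p g
  proof -
    from that have "sublist [p] (\<Delta> g)" by (auto simp: sublist_def dest: split_list)
    then show ?thesis using \<Delta>_prod_list[of "[p]" g] by (simp add: l(3))
  qed
  \<comment> \<open>Without pieces \<open>B\<close> could be negative, hence
    \<open>max 0 B\<close>.\<close>
  interpret continuous_setting \<P>' \<Delta> R \<phi> \<psi> "max 0 B" W s
  proof
    show "\<bar>\<phi> p\<bar> \<le> max 0 B" if "p \<in> \<P>'" for p
      using that l(1)[of p] \<P>' \<phi>_l[of p] by (fastforce simp: \<P>'_def)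
    show "\<phi> (inverse g) = - \<phi> g" for g
    proof -
      have "sum_list (map l (inv_seq gs)) = - sum_list (map l gs)" if "set gs \<subseteq> \<P>" for gs
        using that by (induction gs) (simp_all add: inv_seq_def l(2))
      then show ?thesis
        using pieces[of g] \<P>' unfolding l(3) \<Delta>_inverse by blast
    qed
    show "\<phi> g = sum_list (map \<phi> (\<Delta> g))" for g
      using \<phi>_l[of _ g] by (simp add: l(3)[of g] cong: map_cong)
    show "\<psi> (inverse g) = - \<psi> g" for g
      using \<psi> by (simp add: delta_continuous_def symmetric_map_def)
  qed (use W s in auto)
  have "\<zeta> = zeta" "\<eta> = eta" "\<gamma> = gamma"
    by (simp_all add: fun_eq_iff zeta_def eta_def gamma_def \<zeta> \<eta> \<gamma> \<omega>)
  then have "\<bar>\<beta> g h i\<bar> \<le> 153 * R * M + 7 / 4 * K" for g h i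
    using beta_bounded[of g h i] by (simp add: \<beta> \<omega>)
  then show ?thesis unfolding bounded_3cochain_def by blast
qed

end
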